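(* Let $K$ be a finite simplicial complex, $g\colon V(K)\to\mathbb{R}$ a real-valued function on its vertex set, and $\alpha<\beta$ real numbers. (A) If $g^{-1}\big((\alpha,\beta]\big)$ contains no strong critical vertices, then $K_\beta$ strong collapses to $K_\alpha$. (B) If $g^{-1}\big((\alpha,\beta]\big)$ contains a single strong critical vertex $w$, then $K_\beta$ is homotopy equivalent to a CW-complex of the form $K_\alpha\cup\bigcup_i e_i$, where the cells $e_i$ are in one-to-one correspondence with the simplices in $\mathrm{st}^{\downarrow}(w,K)$; this correspondence preserves dimensions, the attaching maps of the cells $e_i$ are induced from those of the corresponding simplices and the strong deformation retraction $|K_{g(w)}\smallsetminus w|\to|K_\alpha|$ determined by a strong collapse, and the resulting CW-complex structure is regular.
   Context: For a simplicial complex $K$ and a vertex $v$: $\mathrm{st}(v,K)$ is the set of simplices of $K$ containing $v$; $K\smallsetminus v$ is the subcomplex of simplices not containing $v$; $\mathrm{lk}(v,K)$ is the subcomplex of those $\sigma\in K\smallsetminus v$ with $\sigma\cup\{v\}\in K$. A simplicial cone $a*K_0$ with apex $a\notin K_0$ consists of the simplices of $K_0$, the vertex $\{a\}$ and all $\sigma\cup\{a\}$ with $\sigma\in K_0$. A vertex $v$ is dominated by $a$ in $K$ if $\mathrm{lk}(v,K)=a*K_0$ for some subcomplex $K_0$; then there is an elementary strong collapse from $K$ to $K\smallsetminus v$, and the simplicial map $r_a\colon K\to K\smallsetminus v$ sending $v$ to $a$ and fixing all other vertices induces a strong deformation retraction $|r_a|$. A strong collapse from $K$ to a subcomplex $L$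 is a finite (possibly empty) sequence of elementary strong collapses from $K$ to $L$; the composition of the corresponding maps $|r_a|$ is the strong deformation retraction $|K|\to|L|$ determined by it. For $g\colon V(K)\to\mathbb{R}$, $K_\alpha$ is the subcomplex of all simplices all of whose vertices $x$ satisfy $g(x)\le\alpha$; $\mathrm{st}^{\downarrow}(v,K)=\mathrm{st}(v,K_{g(v)})$ is the descending open star. A vertex $v$ is descending dominated if it is dominated in $K_{g(v)}$ by a vertex $a$ with $g(a)<g(v)$; otherwise it is a strong critical vertex. In (B), the attaching maps being "induced" means: as a space, $K_\alpha\cup\bigcup_i e_i$ is the pushout of the inclusion $|K_{g(w)}\smallsetminus w|\hookrightarrow|K_{g(w)}|$ and the retraction $|K_{g(w)}\smallsetminus w|\to|K_\alpha|$, and the cells $e_i$ are the images of the open simplices of $K_{g(w)}$ containing $w$. A CW-complex is regular if the attaching map of each $n$-cell is a homeomorphism from $S^{n-1}$ onto its image. *)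

theory Defs
  imports "HOL-Analysis.Analysis"
begin

section \<open>Finite simplicial complexes\<close>

text \<open>A complex is its set of simplices. The empty set is never a simplex, and the complex
  without simplices is allowed.\<close>

definition fin_complex :: "'a set set \<Rightarrow> bool" where
  "fin_complex K \<longleftrightarrow> finite K \<and> (\<forall>\<sigma>\<in>K. finite \<sigma> \<and> \<sigma> \<noteq> {}) \<and>
     (\<forall>\<sigma>\<in>K. \<forall>\<tau>. \<tau> \<subseteq> \<sigma> \<and> \<tau> \<noteq> {} \<longrightarrow> \<tau> \<in> K)"

definition vertices :: "'a set set \<Rightarrow> 'a set" where
  "vertices K = \<Union>K"

definition simplex_dim :: "'a set \<Rightarrow> nat" where
  "simplex_dim \<sigma> = card \<sigma> - 1"

definition open_star :: "'a \<Rightarrow> 'a set set \<Rightarrow> 'a set set" where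
  "open_star v K = {\<sigma>\<in>K. v \<in> \<sigma>}"

definition delete_vertex :: "'a set set \<Rightarrow> 'a \<Rightarrow> 'a set set" where
  "delete_vertex K v = {\<sigma>\<in>K. v \<notin> \<sigma>}"

definition link :: "'a \<Rightarrow> 'a set set \<Rightarrow> 'a set set" where
  "link v K = {\<sigma> \<in> delete_vertex K v. \<sigma> \<union> {v} \<in> K}"

definition simplicial_cone :: "'a \<Rightarrow> 'a set set \<Rightarrow> 'a set set" where
  "simplicial_cone a K0 = K0 \<union> {{a}} \<union> {\<sigma> \<union> {a} |\<sigma>. \<sigma> \<in> K0}"

text \<open>The base of the cone may be empty, in which case the link is the single vertex \<open>a\<close>.\<close>

definition dominated_by :: "'a set set \<Rightarrow> 'a \<Rightarrow> 'a \<Rightarrow> bool" where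
  "dominated_by K v a \<longleftrightarrow> v \<in> vertices K \<and>
     (\<exists>K0. fin_complex K0 \<and> K0 \<subseteq> K \<and> a \<notin> vertices K0 \<and> link v K = simplicial_cone a K0)"


section \<open>Sublevel complexes and strong critical vertices\<close>

definition sublevel :: "('a \<Rightarrow> real) \<Rightarrow> 'a set set \<Rightarrow> real \<Rightarrow> 'a set set" where
  "sublevel g K \<alpha> = {\<sigma>\<in>K. \<forall>x\<in>\<sigma>. g x \<le> \<alpha>}"

definition descending_star :: "('a \<Rightarrow> real) \<Rightarrow> 'a set set \<Rightarrow> 'a \<Rightarrow> 'a set set" where
  "descending_star g K v = open_star v (sublevel g K (g v))"

definition descending_dominated :: "('a \<Rightarrow> real) \<Rightarrow> 'a set set \<Rightarrow> 'a \<Rightarrow> bool" where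
  "descending_dominated g K v \<longleftrightarrow> (\<exists>a. g a < g v \<and> dominated_by (sublevel g K (g v)) v a)"

definition strong_critical :: "('a \<Rightarrow> real) \<Rightarrow> 'a set set \<Rightarrow> 'a \<Rightarrow> bool" where
  "strong_critical g K v \<longleftrightarrow> v \<in> vertices K \<and> \<not> descending_dominated g K v"


section \<open>Geometric realization\<close>

text \<open>Points are given by their barycentric coordinates. For a finite complex the product
  topology on \<open>'a \<Rightarrow> real\<close> induces the usual topology of the realization.\<close>

definition open_simplex :: "'a set \<Rightarrow> ('a \<Rightarrow> real) set" where
  "open_simplex \<sigma> = {x. (\<forall>v\<in>\<sigma>. 0 < x v) \<and> (\<forall>v. v \<notin> \<sigma> \<longrightarrow> x v = 0) \<and> (\<Sum>v\<in>\<sigma>. x v) = 1}"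

definition realization :: "'a set set \<Rightarrow> ('a \<Rightarrow> real) topology" where
  "realization K = subtopology (powertop_real UNIV) (\<Union>\<sigma>\<in>K. open_simplex \<sigma>)"

text \<open>The affine extension of a vertex map: the coordinate at \<open>u\<close> of the image of \<open>x\<close> is the sum
  of the coordinates of \<open>x\<close> over the fibre of \<open>u\<close>.\<close>

definition realization_map :: "('a \<Rightarrow> 'a) \<Rightarrow> ('a \<Rightarrow> real) \<Rightarrow> ('a \<Rightarrow> real)" where
  "realization_map f x = (\<lambda>u. \<Sum>v | x v \<noteq> 0 \<and> f v = u. x v)"


section \<open>Strong collapses\<close>

text \<open>\<open>strong_collapse K L r\<close>: there is a sequence of elementary strong collapses from \<open>K\<close> to \<open>L\<close>,
  and \<open>r\<close> is the composition of the associated maps of realizations. Only the values of \<open>r\<close>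
  on the realization of \<open>K\<close> are meaningful.\<close>

inductive strong_collapse ::
    "'a set set \<Rightarrow> 'a set set \<Rightarrow> (('a \<Rightarrow> real) \<Rightarrow> ('a \<Rightarrow> real)) \<Rightarrow> bool" where
  refl: "strong_collapse K K id"
| step: "dominated_by K v a \<Longrightarrow> strong_collapse (delete_vertex K v) L r \<Longrightarrow>
         strong_collapse K L (r \<circ> realization_map (id(v := a)))"

definition strong_collapses_to :: "'a set set \<Rightarrow> 'a set set \<Rightarrow> bool" where
  "strong_collapses_to K L \<longleftrightarrow> (\<exists>r. strong_collapse K L r)"


section \<open>Quotient spaces and pushouts\<close>

definition quotient_topology :: "'b topology \<Rightarrow> ('b \<times> 'b) set \<Rightarrow> 'b set topology" where
  "quotient_topology X R =
     topology (\<lambda>U. U \<subseteq> topspace X // R \<and> openin X (\<Union>U))"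

lemma istopology_quotient:
  assumes "equiv (topspace X) R"
  shows "istopology (\<lambda>U. U \<subseteq> topspace X // R \<and> openin X (\<Union>U))"
proof -
  have "\<Union>(S \<inter> T) = \<Union>S \<inter> \<Union>T"
    if "S \<subseteq> topspace X // R" "T \<subseteq> topspace X // R" for S T
  proof
    show "\<Union>S \<inter> \<Union>T \<subseteq> \<Union>(S \<inter> T)"
    proof
      fix x assume "x \<in> \<Union>S \<inter> \<Union>T"
      then obtain A B where AB: "A \<in> S" "B \<in> T" "x \<in> A" "x \<in> B" by auto
      then have "A = B"
        using quotient_disj[OF assms, of A B] that by blast
      then show "x \<in> \<Union>(S \<inter> T)" using AB by auto
    qed
  qed blast
  moreover have "openin X (\<Union>(\<Union>\<K>))" if "\<And>U. U \<in> \<K> \<Longrightarrow> openin X (\<Union>U)" for \<K>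
  proof -
    have "\<Union>(\<Union>\<K>) = \<Union>(Union ` \<K>)"
      by blast
    then show ?thesis
      using that by (auto intro: openin_Union)
  qed
  ultimately show ?thesis
    unfolding istopology_def by (simp add: openin_Int le_infI1 Sup_le_iff)
qed

lemma openin_quotient_topology:
  assumes "equiv (topspace X) R"
  shows "openin (quotient_topology X R) U \<longleftrightarrow> U \<subseteq> topspace X // R \<and> openin X (\<Union>U)"
  unfolding quotient_topology_def using istopology_quotient[OF assms] by simp

text \<open>Pushout of \<open>i : C \<rightarrow> X\<close> and \<open>f : C \<rightarrow> Y\<close>: in the disjoint union, \<open>X\<close> carries the tag \<open>True\<close>
  and \<open>Y\<close> the tag \<open>False\<close>, and \<open>(True, i c)\<close> is glued to \<open>(False, f c)\<close> for every \<open>c\<close> in \<open>C\<close>.\<close>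

definition disjoint_union :: "'b topology \<Rightarrow> 'b topology \<Rightarrow> (bool \<times> 'b) topology" where
  "disjoint_union X Y = sum_topology (\<lambda>t. if t then X else Y) UNIV"

definition glue_rel ::
    "'c topology \<Rightarrow> 'b topology \<Rightarrow> 'b topology \<Rightarrow> ('c \<Rightarrow> 'b) \<Rightarrow> ('c \<Rightarrow> 'b)
      \<Rightarrow> ((bool \<times> 'b) \<times> (bool \<times> 'b)) set" where
  "glue_rel C X Y i f =
     (let S = {((True, i c), (False, f c)) |c. c \<in> topspace C};
          T = topspace (disjoint_union X Y)
      in (S \<union> S\<inverse>)\<^sup>* \<inter> (T \<times> T))"

lemma equiv_glue_rel: "equiv (topspace (disjoint_union X Y)) (glue_rel C X Y i f)"
proof -
  have "sym ((S \<union> S\<inverse>)\<^sup>*)" for S :: "((bool \<times> 'a) \<times> (bool \<times> 'a)) set"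
    by (intro sym_rtrancl) (auto simp: sym_def)
  then show ?thesis
    unfolding equiv_def glue_rel_def Let_def refl_on_def
    by (auto simp: sym_def intro!: transI)
qed

definition pushout ::
    "'c topology \<Rightarrow> 'b topology \<Rightarrow> 'b topology \<Rightarrow> ('c \<Rightarrow> 'b) \<Rightarrow> ('c \<Rightarrow> 'b)
      \<Rightarrow> (bool \<times> 'b) set topology" where
  "pushout C X Y i f = quotient_topology (disjoint_union X Y) (glue_rel C X Y i f)"

definition pushout_in1 ::
    "'c topology \<Rightarrow> 'b topology \<Rightarrow> 'b topology \<Rightarrow> ('c \<Rightarrow> 'b) \<Rightarrow> ('c \<Rightarrow> 'b)
      \<Rightarrow> 'b \<Rightarrow> (bool \<times> 'b) set" where
  "pushout_in1 C X Y i f x = glue_rel C X Y i f `` {(True, x)}"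

definition pushout_in2 ::
    "'c topology \<Rightarrow> 'b topology \<Rightarrow> 'b topology \<Rightarrow> ('c \<Rightarrow> 'b) \<Rightarrow> ('c \<Rightarrow> 'b)
      \<Rightarrow> 'b \<Rightarrow> (bool \<times> 'b) set" where
  "pushout_in2 C X Y i f y = glue_rel C X Y i f `` {(False, y)}"


section \<open>CW-complexes\<close>

definition cdisc :: "nat \<Rightarrow> (nat \<Rightarrow> real) topology" where
  "cdisc n = subtopology (Euclidean_space n) {x. (\<Sum>i<n. (x i)\<^sup>2) \<le> 1}"

definition odisc :: "nat \<Rightarrow> (nat \<Rightarrow> real) topology" where
  "odisc n = subtopology (Euclidean_space n) {x. (\<Sum>i<n. (x i)\<^sup>2) < 1}"

text \<open>The boundary of \<open>cdisc n\<close>, that is the sphere of dimension \<open>n - 1\<close>; empty for \<open>n = 0\<close>.\<close>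

definition bsphere :: "nat \<Rightarrow> (nat \<Rightarrow> real) topology" where
  "bsphere n = subtopology (Euclidean_space n) {x. (\<Sum>i<n. (x i)\<^sup>2) = 1}"

text \<open>\<open>X\<close> is a CW-complex with open cells \<open>e i\<close> of dimension \<open>d i\<close> and characteristic maps
  \<open>\<Phi> i\<close>; the restriction of \<open>\<Phi> i\<close> to the boundary sphere is the attaching map. The last two
  conditions are closure-finiteness (with boundaries in the lower skeleton) and the weak topology.\<close>

definition cw_complex ::
    "'x topology \<Rightarrow> 'i set \<Rightarrow> ('i \<Rightarrow> 'x set) \<Rightarrow> ('i \<Rightarrow> nat) \<Rightarrow> ('i \<Rightarrow> (nat \<Rightarrow> real) \<Rightarrow> 'x) \<Rightarrow> bool" where
  "cw_complex X I e d \<Phi> \<longleftrightarrow>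
     Hausdorff_space X \<and>
     disjoint_family_on e I \<and> (\<Union>i\<in>I. e i) = topspace X \<and>
     (\<forall>i\<in>I. continuous_map (cdisc (d i)) X (\<Phi> i) \<and>
            homeomorphic_map (odisc (d i)) (subtopology X (e i)) (\<Phi> i)) \<and>
     (\<forall>i\<in>I. \<exists>J\<subseteq>I. finite J \<and> (\<forall>j\<in>J. d j < d i) \<and>
            \<Phi> i ` topspace (bsphere (d i)) \<subseteq> (\<Union>j\<in>J. e j)) \<and>
     (\<forall>A. A \<subseteq> topspace X \<longrightarrow>
          (closedin X A \<longleftrightarrow> (\<forall>i\<in>I. closedin X (A \<inter> X closure_of (e i)))))"

text \<open>Regularity is a property of the decomposition of \<open>X\<close> into cells: there are characteristic maps
  whose attaching maps are all homeomorphisms onto their images.\<close>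

definition regular_cw_complex ::
    "'x topology \<Rightarrow> 'i set \<Rightarrow> ('i \<Rightarrow> 'x set) \<Rightarrow> ('i \<Rightarrow> nat) \<Rightarrow> bool" where
  "regular_cw_complex X I e d \<longleftrightarrow>
     (\<exists>\<Phi>. cw_complex X I e d \<Phi> \<and>
          (\<forall>i\<in>I. homeomorphic_map (bsphere (d i))
                    (subtopology X (\<Phi> i ` topspace (bsphere (d i)))) (\<Phi> i)))"


section \<open>Attaching the descending star along a strong collapse\<close>

text \<open>The pushout of the inclusion of the realization of \<open>delete_vertex L w\<close> into that of \<open>L\<close> and
  of \<open>r\<close>, a map from the realization of \<open>delete_vertex L w\<close> to that of \<open>M\<close>.\<close>

definition attach_space ::
    "'a set set \<Rightarrow> 'a \<Rightarrow> 'a set set \<Rightarrow> (('a \<Rightarrow> real) \<Rightarrow> ('a \<Rightarrow> real))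
      \<Rightarrow> (bool \<times> ('a \<Rightarrow> real)) set topology" where
  "attach_space L w M r =
     pushout (realization (delete_vertex L w)) (realization L) (realization M) id r"

text \<open>The cells are indexed by the simplices of \<open>M\<close> (left summand), giving \<open>M\<close> as a subcomplex, and
  by the simplices of \<open>L\<close> containing \<open>w\<close> (right summand), giving the attached cells.\<close>

fun attach_cell ::
    "'a set set \<Rightarrow> 'a \<Rightarrow> 'a set set \<Rightarrow> (('a \<Rightarrow> real) \<Rightarrow> ('a \<Rightarrow> real))
      \<Rightarrow> 'a set + 'a set \<Rightarrow> (bool \<times> ('a \<Rightarrow> real)) set set" where
  "attach_cell L w M r (Inl \<sigma>) =
     pushout_in2 (realization (delete_vertex L w)) (realization L) (realization M) id r
       ` open_simplex \<sigma>"
| "attach_cell L w M r (Inr \<sigma>) =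
     pushout_in1 (realization (delete_vertex L w)) (realization L) (realization M) id r
       ` open_simplex \<sigma>"

end

theory Submission
  imports Defs
begin

text \<open>Vertices are deleted in the order of decreasing \<open>g\<close>; a non-critical vertex is dominated by a
  vertex of smaller value, which is still present, so that its deletion is an elementary strong
  collapse. This gives (A), and for (B) collapses from \<open>K\<^sub>\<beta>\<close> to \<open>L = K\<^bsub>g(w)\<^esub>\<close> and from
  \<open>C = L - w\<close> to \<open>M = K\<^sub>\<alpha>\<close>.

  A strong collapse is the realization of a simplicial map, and it is homotopic to the identity through
  maps preserving its fibres. The homotopy on \<open>|C|\<close> extends to \<open>|L|\<close> and, because it preserves the
  fibres of \<open>r\<close>, descends to the pushout, which is therefore homotopy equivalent to \<open>|L|\<close>.

  The attaching map of the cell of a simplex \<open>\<sigma> \<ni> w\<close> induced by the usual characteristic map is in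
  general not injective, since \<open>r\<close> collapses the facet opposite \<open>w\<close> linearly. The closed cell is
  nevertheless a disc whose boundary sphere is the image of the boundary of \<open>\<sigma>\<close>: there is a map from
  \<open>\<sigma>\<close> onto an explicit convex polytope with the same fibres as the map from \<open>\<sigma>\<close> to the pushout.\<close>

section \<open>Barycentric coordinates\<close>

text \<open>Since \<open>r\<close> fixes the points of |M|, each of them is glued to itself, and the
  pushout becomes a quotient of |L| alone: two distinct points are identified exactly when both lie
  in |C| and have the same image under \<open>r\<close>. One map \<open>q\<close> therefore carries
  the whole topology. Once the pushout is known to be Hausdorff, compactness does the rest:
  continuous surjections are quotient maps, continuous injections are embeddings, and the product of
  \<open>q\<close> with an interval is again a quotient map. Each descent argument thus reduces to a
  comparison of fibres.

  Simplices of C outside M leave no cell behind, because their points are represented in M. A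
  simplicial map never raises dimension, so these representatives lie in cells small enough for the
  boundary condition of a CW-complex.

  That the polytope is a disc is the usual radial argument: around an interior point, every ray is
  rescaled by the ratio of the Euclidean norm to the gauge function of the polytope.\<close>

definition supp :: "('a \<Rightarrow> real) \<Rightarrow> 'a set" where
  "supp x = {v. x v \<noteq> 0}"

text \<open>A sum over an infinite set is 0 by convention, so total mass 1 already forces the
  support to be finite.\<close>

definition barycentric :: "('a \<Rightarrow> real) \<Rightarrow> bool" where
  "barycentric x \<longleftrightarrow> (\<forall>v. 0 \<le> x v) \<and> sum x (supp x) = 1"

lemma supp_finite: "barycentric x \<Longrightarrow> finite (supp x)"
  unfolding barycentric_def by (metis sum.infinite zero_neq_one)

lemma supp_nonempty: "barycentric x \<Longrightarrow> supp x \<noteq> {}"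
  unfolding barycentric_def by auto

lemma sum_supp:
  assumes "finite V" "supp x \<subseteq> V"
  shows "sum x V = sum x (supp x)"
  using assms by (intro sum.mono_neutral_right) (auto simp: supp_def)

lemma barycentricI:
  assumes "finite V" "supp x \<subseteq> V" "\<And>v. 0 \<le> x v" "sum x V = 1"
  shows "barycentric x"
  using assms sum_supp[of V x] by (auto simp: barycentric_def)

lemma barycentric_sum:
  assumes "barycentric x" "finite V" "supp x \<subseteq> V"
  shows "sum x V = 1"
  using assms sum_supp[of V x] by (auto simp: barycentric_def)

lemma barycentric_le_1:
  assumes "barycentric x" shows "x v \<le> 1"
proof -
  have "x v \<le> sum x (insert v (supp x))"
    using supp_finite[OF assms] assms by (intro member_le_sum) (auto simp: barycentric_def)
  also have "\<dots> = 1" using assms supp_finite[OF assms] by (intro barycentric_sum) auto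
  finally show ?thesis .
qed

lemma mem_open_simplex: "x \<in> open_simplex \<sigma> \<longleftrightarrow> barycentric x \<and> supp x = \<sigma>"
proof
  assume x: "x \<in> open_simplex \<sigma>"
  then have "supp x = \<sigma>" by (fastforce simp: open_simplex_def supp_def)
  moreover have "0 \<le> x v" for v
    using x by (cases "v \<in> \<sigma>") (auto simp: open_simplex_def less_imp_le)
  ultimately show "barycentric x \<and> supp x = \<sigma>"
    using x by (auto simp: barycentric_def open_simplex_def)
next
  assume "barycentric x \<and> supp x = \<sigma>"
  then show "x \<in> open_simplex \<sigma>"
    unfolding barycentric_def open_simplex_def supp_def by (auto simp: less_le)
qed

definition points :: "'a set set \<Rightarrow> ('a \<Rightarrow> real) set" where
  "points K = {x. barycentric x \<and> supp x \<in> K}"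

lemma points_mono: "K \<subseteq> L \<Longrightarrow> points K \<subseteq> points L"
  by (auto simp: points_def)

lemma open_simplex_subset_points: "\<sigma> \<in> K \<Longrightarrow> open_simplex \<sigma> \<subseteq> points K"
  by (auto simp: points_def mem_open_simplex)

lemma realization_eq: "realization K = top_of_set (points K)"
proof -
  have "(\<Union>\<sigma>\<in>K. open_simplex \<sigma>) = points K"
    by (auto simp: points_def mem_open_simplex)
  then show ?thesis by (simp add: realization_def euclidean_product_topology)
qed

lemma topspace_realization [simp]: "topspace (realization K) = points K"
  by (simp add: realization_eq)

lemma realization_subtopology: "K \<subseteq> L \<Longrightarrow> realization K = subtopology (realization L) (points K)"
  by (simp add: realization_eq subtopology_subtopology points_mono inf.absorb2)

lemma Hausdorff_fun: "Hausdorff_space (euclidean :: ('a \<Rightarrow> real) topology)"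
  unfolding euclidean_product_topology[symmetric] by (simp add: Hausdorff_space_product_topology)

text \<open>This is Tychonoff's theorem, as the type of vertices may be infinite. Closed simplices
  are compact as closed subsets of this cube.\<close>

lemma compact_unit_cube: "compact {x :: 'a \<Rightarrow> real. \<forall>v. 0 \<le> x v \<and> x v \<le> 1}"
proof -
  have "compactin (powertop_real UNIV) (PiE UNIV (\<lambda>_::'a. {0..1::real}))"
    by (simp add: compactin_PiE)
  moreover have "PiE UNIV (\<lambda>_::'a. {0..1::real}) = {x. \<forall>v. 0 \<le> x v \<and> x v \<le> 1}"
    by (auto simp: PiE_UNIV_domain)
  ultimately show ?thesis by (simp add: euclidean_product_topology)
qed

lemma continuous_on_coordinate [continuous_intros]:
  "continuous_on S (\<lambda>x :: 'a \<Rightarrow> real. x v)"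
  by (rule continuous_on_subset[OF continuous_on_product_coordinates subset_UNIV])

lemma fin_complex_finite: "fin_complex K \<Longrightarrow> \<sigma> \<in> K \<Longrightarrow> finite \<sigma>"
  by (auto simp: fin_complex_def)

lemma fin_complex_face: "fin_complex K \<Longrightarrow> \<sigma> \<in> K \<Longrightarrow> \<tau> \<subseteq> \<sigma> \<Longrightarrow> \<tau> \<noteq> {} \<Longrightarrow> \<tau> \<in> K"
  unfolding fin_complex_def by blast

lemma finite_vertices: "fin_complex K \<Longrightarrow> finite (vertices K)"
  by (auto simp: fin_complex_def vertices_def)

lemma vertex_simplex: "fin_complex K \<Longrightarrow> v \<in> vertices K \<Longrightarrow> {v} \<in> K"
  by (auto simp: vertices_def fin_complex_face)

lemma simplex_subset_vertices: "\<sigma> \<in> K \<Longrightarrow> \<sigma> \<subseteq> vertices K"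
  by (auto simp: vertices_def)

lemma fin_complex_subset:
  assumes "fin_complex K" "L \<subseteq> K" "\<And>\<sigma> \<tau>. \<sigma> \<in> L \<Longrightarrow> \<tau> \<in> K \<Longrightarrow> \<tau> \<subseteq> \<sigma> \<Longrightarrow> \<tau> \<in> L"
  shows "fin_complex L"
  using assms unfolding fin_complex_def by (meson finite_subset subsetD)

lemma closed_face: "closed {x :: 'a \<Rightarrow> real. (\<forall>v. v \<notin> \<sigma> \<longrightarrow> x v = 0) \<and> sum x \<sigma> = 1}"
proof -
  have "{x :: 'a \<Rightarrow> real. (\<forall>v. v \<notin> \<sigma> \<longrightarrow> x v = 0) \<and> sum x \<sigma> = 1} =
      (\<Inter>v\<in>-\<sigma>. {x. x v = 0}) \<inter> {x. sum x \<sigma> = 1}" by auto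
  moreover have "closed {x :: 'a \<Rightarrow> real. x v = 0}" for v
    by (intro closed_Collect_eq continuous_intros)
  moreover have "closed {x :: 'a \<Rightarrow> real. sum x \<sigma> = 1}"
    by (intro closed_Collect_eq continuous_intros)
  ultimately show ?thesis by (simp add: closed_INT closed_Int)
qed

lemma compact_points:
  fixes K :: "'a set set"
  assumes K: "fin_complex K"
  shows "compact (points K)"
proof -
  let ?F = "\<lambda>\<sigma>. {x :: 'a \<Rightarrow> real. \<forall>v. 0 \<le> x v \<and> x v \<le> 1} \<inter>
     {x. (\<forall>v. v \<notin> \<sigma> \<longrightarrow> x v = 0) \<and> sum x \<sigma> = 1}"
  have "points K = (\<Union>\<sigma>\<in>K. ?F \<sigma>)"
  proof (intro equalityI subsetI)
    fix x assume x: "x \<in> points K"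
    then have b: "barycentric x" and s: "supp x \<in> K" by (auto simp: points_def)
    have "x \<in> ?F (supp x)"
      using b barycentric_le_1[OF b] by (auto simp: barycentric_def supp_def)
    then show "x \<in> (\<Union>\<sigma>\<in>K. ?F \<sigma>)" using s by blast
  next
    fix x assume "x \<in> (\<Union>\<sigma>\<in>K. ?F \<sigma>)"
    then obtain \<sigma> where s: "\<sigma> \<in> K" and x: "x \<in> ?F \<sigma>" by blast
    have b: "barycentric x"
      using x s by (intro barycentricI[of \<sigma>]) (auto simp: supp_def fin_complex_finite[OF K])
    moreover have "supp x \<subseteq> \<sigma>" using x by (auto simp: supp_def)
    ultimately show "x \<in> points K"
      using s supp_nonempty[OF b] fin_complex_face[OF K s] by (auto simp: points_def)
  qed
  moreover have "compact (?F \<sigma>)" for \<sigma>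
    using compact_unit_cube closed_face[of \<sigma>] by (rule compact_Int_closed)
  moreover have "finite K" using K by (simp add: fin_complex_def)
  ultimately show ?thesis by (simp only: compact_UN)
qed

lemma compact_space_realization: "fin_complex K \<Longrightarrow> compact_space (realization K)"
  by (simp add: realization_eq compact_space_subtopology compact_points)

text \<open>A closed simplex is treated as a complex of its own, so that facts about realizations
  apply to it. Its boundary is
  \<open>points (full_simplex \<sigma>) - open_simplex \<sigma>\<close>.\<close>

definition full_simplex :: "'a set \<Rightarrow> 'a set set" where
  "full_simplex \<sigma> = {\<tau>. \<tau> \<subseteq> \<sigma> \<and> \<tau> \<noteq> {}}"

lemma fin_complex_full_simplex: "finite \<sigma> \<Longrightarrow> fin_complex (full_simplex \<sigma>)"
  by (auto simp: fin_complex_def full_simplex_def intro: finite_subset)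

lemma full_simplex_subset: "fin_complex K \<Longrightarrow> \<sigma> \<in> K \<Longrightarrow> full_simplex \<sigma> \<subseteq> K"
  using fin_complex_face[of K \<sigma>] by (auto simp: full_simplex_def)

lemma points_full_simplex: "x \<in> points (full_simplex \<sigma>) \<longleftrightarrow> barycentric x \<and> supp x \<subseteq> \<sigma>"
  using supp_nonempty by (auto simp: points_def full_simplex_def)

section \<open>Affine extensions of vertex maps\<close>

text \<open>The sum in the definition ranges over a set that depends on \<open>x\<close>. Over a
  fixed finite \<open>V\<close> the formula is visibly linear and continuous in
  \<open>x\<close>.\<close>

lemma realization_map_eq:
  assumes "finite V" "supp x \<subseteq> V"
  shows "realization_map f x u = (\<Sum>v | v \<in> V \<and> f v = u. x v)"
  unfolding realization_map_def
  using assms by (intro sum.mono_neutral_left) (auto simp: supp_def)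

text \<open>Nonnegative coordinates cannot cancel inside a fibre, so no vertex of the image is
  lost.\<close>

lemma supp_realization_map:
  assumes "barycentric x"
  shows "supp (realization_map f x) = f ` supp x"
proof -
  have fin: "finite (supp x)" using supp_finite[OF assms] .
  have nn: "0 \<le> x v" for v using assms by (auto simp: barycentric_def)
  have "realization_map f x u \<noteq> 0 \<longleftrightarrow> u \<in> f ` supp x" for u
  proof -
    have "realization_map f x u = 0 \<longleftrightarrow> (\<forall>v\<in>{v \<in> supp x. f v = u}. x v = 0)"
      unfolding realization_map_eq[OF fin subset_refl] using fin nn
      by (subst sum_nonneg_eq_0_iff) auto
    then show ?thesis by (auto simp: supp_def)
  qed
  then show ?thesis by (auto simp: supp_def)
qed

lemma realization_map_nonneg: "(\<And>v. 0 \<le> x v) \<Longrightarrow> 0 \<le> realization_map f x u"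
  unfolding realization_map_def by (rule sum_nonneg) auto

lemma sum_realization_map:
  assumes "finite V" "supp x \<subseteq> V"
  shows "sum (realization_map f x) (f ` V) = sum x V"
proof -
  have "sum (realization_map f x) (f ` V) = (\<Sum>u\<in>f ` V. \<Sum>v | v \<in> V \<and> f v = u. x v)"
    by (simp add: realization_map_eq[OF assms])
  also have "\<dots> = sum x V" using sum.image_gen[OF assms(1), of x f] by simp
  finally show ?thesis .
qed

lemma barycentric_realization_map:
  assumes "barycentric x" shows "barycentric (realization_map f x)"
  using assms supp_finite[OF assms] sum_realization_map[OF supp_finite[OF assms] subset_refl, of f]
  by (intro barycentricI[of "f ` supp x"])
    (auto simp: supp_realization_map barycentric_def realization_map_nonneg)

lemma realization_map_points:
  assumes "\<And>\<sigma>. \<sigma> \<in> K \<Longrightarrow> f ` \<sigma> \<in> L" "x \<in> points K"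
  shows "realization_map f x \<in> points L"
  using assms by (auto simp: points_def supp_realization_map barycentric_realization_map)

lemma realization_map_fixes:
  assumes "\<And>v. x v \<noteq> 0 \<Longrightarrow> f v = v"
  shows "realization_map f x = x"
proof
  fix u
  have "{v. x v \<noteq> 0 \<and> f v = u} = (if x u \<noteq> 0 then {u} else {})" using assms by auto
  then show "realization_map f x u = x u" by (auto simp: realization_map_def)
qed

lemma realization_map_comp:
  assumes fin: "finite (supp x)"
  shows "realization_map f (realization_map h x) = realization_map (f \<circ> h) x"
proof
  fix u
  let ?V = "supp x" and ?y = "realization_map h x"
  have "supp ?y \<subseteq> h ` ?V"
  proof
    fix b assume "b \<in> supp ?y"
    then have "(\<Sum>v | v \<in> ?V \<and> h v = b. x v) \<noteq> 0"
      using realization_map_eq[OF fin subset_refl, of h b] by (auto simp: supp_def)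
    then have "{v \<in> ?V. h v = b} \<noteq> {}" by (metis sum.empty)
    then show "b \<in> h ` ?V" by auto
  qed
  then have "realization_map f ?y u = (\<Sum>b | b \<in> h ` ?V \<and> f b = u. ?y b)"
    using fin by (intro realization_map_eq) auto
  also have "\<dots> = (\<Sum>b | b \<in> h ` ?V \<and> f b = u. \<Sum>v | v \<in> ?V \<and> h v = b. x v)"
    by (simp add: realization_map_eq[OF fin subset_refl])
  also have "\<dots> = (\<Sum>b \<in> h ` {v \<in> ?V. f (h v) = u}. \<Sum>v | v \<in> {v \<in> ?V. f (h v) = u} \<and> h v = b. x v)"
    by (intro sum.cong) auto
  also have "\<dots> = (\<Sum>v | v \<in> ?V \<and> (f \<circ> h) v = u. x v)"
    using fin by (subst sum.image_gen[symmetric]) auto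
  also have "\<dots> = realization_map (f \<circ> h) x u"
    by (simp add: realization_map_eq[OF fin subset_refl])
  finally show "realization_map f ?y u = realization_map (f \<circ> h) x u" .
qed

text \<open>Linearity is what makes fibres convex: a segment whose two ends have the same image is
  mapped to a single point.\<close>

lemma realization_map_affine:
  assumes "finite (supp x)" "finite (supp y)"
  shows "realization_map f (\<lambda>v. a * x v + b * y v) =
    (\<lambda>u. a * realization_map f x u + b * realization_map f y u)"
proof
  fix u
  let ?V = "supp x \<union> supp y"
  have fin: "finite ?V" using assms by simp
  have "supp (\<lambda>v. a * x v + b * y v) \<subseteq> ?V" by (auto simp: supp_def)
  then show "realization_map f (\<lambda>v. a * x v + b * y v) u =
    a * realization_map f x u + b * realization_map f y u"
    using realization_map_eq[OF fin, of x f u] realization_map_eq[OF fin, of y f u]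
    by (simp add: realization_map_eq[OF fin] sum.distrib sum_distrib_left)
qed

lemma continuous_on_realization_map:
  assumes "finite V" "\<And>x. x \<in> S \<Longrightarrow> supp x \<subseteq> V"
  shows "continuous_on S (realization_map f)"
proof (rule continuous_on_coordinatewise_then_product)
  fix u
  have "continuous_on S (\<lambda>x. \<Sum>v | v \<in> V \<and> f v = u. x v)" by (intro continuous_intros)
  then show "continuous_on S (\<lambda>x. realization_map f x u)"
    by (rule continuous_on_eq) (simp add: realization_map_eq[OF assms(1)] assms(2))
qed

lemma continuous_on_realization_map_points:
  assumes "fin_complex K" shows "continuous_on (points K) (realization_map f)"
  by (rule continuous_on_realization_map[of "vertices K"])
    (use assms in \<open>auto simp: finite_vertices points_def dest: simplex_subset_vertices\<close>)

section \<open>Strong collapses\<close>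

lemma fin_complex_delete_vertex: "fin_complex K \<Longrightarrow> fin_complex (delete_vertex K v)"
  by (rule fin_complex_subset[of K]) (auto simp: delete_vertex_def)

lemma delete_vertex_subset: "delete_vertex K v \<subseteq> K"
  by (auto simp: delete_vertex_def)

text \<open>A cone is closed under adding its apex to a simplex. This is the form in which
  domination enters the geometry: \<open>x\<close> and its image under the elementary collapse
  always lie in a common simplex.\<close>

lemma dominated_by_coface:
  assumes K: "fin_complex K" and dom: "dominated_by K v a" and \<sigma>: "\<sigma> \<in> K" "v \<in> \<sigma>"
  shows "insert a \<sigma> \<in> K"
proof -
  obtain K0 where lk: "link v K = simplicial_cone a K0"
    using dom by (auto simp: dominated_by_def)
  have cone: "insert a \<tau> \<in> link v K" if "\<tau> \<in> link v K" for \<tau>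
    using that unfolding lk simplicial_cone_def by (auto simp: insert_absorb)
  show ?thesis
  proof (cases "\<sigma> = {v}")
    \<comment> \<open>The empty face is not a simplex of the link, so this case rests on the vertex
      \<open>{a}\<close> of the cone.\<close>
    case True
    have "{a} \<in> link v K" unfolding lk simplicial_cone_def by auto
    then show ?thesis using True by (simp add: link_def insert_commute)
  next
    case False
    then have "\<sigma> - {v} \<noteq> {}" using \<sigma> by auto
    then have "\<sigma> - {v} \<in> K" by (intro fin_complex_face[OF K \<sigma>(1)]) auto
    then have "\<sigma> - {v} \<in> link v K"
      using \<sigma> by (auto simp: link_def delete_vertex_def insert_absorb)
    then have "insert a (\<sigma> - {v}) \<in> link v K" by (rule cone)
    then show ?thesis using \<sigma> by (auto simp: link_def insert_commute insert_absorb)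
  qed
qed

lemma dominated_by_neq:
  assumes "dominated_by K v a" shows "a \<noteq> v"
proof -
  have "{a} \<in> link v K" using assms by (auto simp: dominated_by_def simplicial_cone_def)
  then show ?thesis by (auto simp: link_def delete_vertex_def)
qed

lemma dominated_by_simplicial:
  assumes K: "fin_complex K" and dom: "dominated_by K v a" and \<sigma>: "\<sigma> \<in> K"
  shows "(id(v := a)) ` \<sigma> \<in> delete_vertex K v"
proof (cases "v \<in> \<sigma>")
  case True
  have im: "(id(v := a)) ` \<sigma> = insert a (\<sigma> - {v})" using True by auto
  have "insert a (\<sigma> - {v}) \<in> K"
    by (rule fin_complex_face[OF K dominated_by_coface[OF K dom \<sigma> True]]) auto
  then show ?thesis unfolding im using dominated_by_neq[OF dom] by (auto simp: delete_vertex_def)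
next
  case False
  then have "(id(v := a)) ` \<sigma> = \<sigma>" by (auto simp: image_iff)
  then show ?thesis using False \<sigma> by (simp add: delete_vertex_def)
qed

lemma convex_combination_points:
  assumes x: "barycentric x" and y: "barycentric y" and K: "fin_complex K" "supp x \<union> supp y \<in> K"
    and t: "0 \<le> t" "t \<le> 1"
  shows "(\<lambda>v. (1 - t) * x v + t * y v) \<in> points K"
proof -
  let ?z = "\<lambda>v. (1 - t) * x v + t * y v" and ?V = "supp x \<union> supp y"
  have sub: "supp ?z \<subseteq> ?V" by (auto simp: supp_def)
  have fin: "finite ?V" using supp_finite x y by blast
  have "sum ?z ?V = (1 - t) * sum x ?V + t * sum y ?V"
    by (simp add: sum.distrib sum_distrib_left)
  also have "\<dots> = 1" using barycentric_sum[OF x fin] barycentric_sum[OF y fin] by simp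
  finally have b: "barycentric ?z"
    using sub fin x y t by (intro barycentricI[of ?V]) (auto simp: barycentric_def)
  then show ?thesis using fin_complex_face[OF K sub supp_nonempty] by (simp add: points_def)
qed

text \<open>The two maps are contiguous: the supports of \<open>p x\<close> and \<open>q x\<close>
  span a simplex, which contains the segment between the two points.\<close>

lemma homotopic_with_convex:
  fixes K L :: "'a set set"
  assumes L: "fin_complex L"
    and p: "continuous_map (realization K) (realization L) p"
    and q: "continuous_map (realization K) (realization L) q"
    and pq: "\<And>x. x \<in> points K \<Longrightarrow> supp (p x) \<union> supp (q x) \<in> L"
    and P: "\<And>t. t \<in> {0..1} \<Longrightarrow> P (\<lambda>x v. (1 - t) * p x v + t * q x v)"
  shows "homotopic_with P (realization K) (realization L) p q"
proof -
  let ?h = "\<lambda>(t::real, x) v. (1 - t) * p x v + t * q x v"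
  have pc: "continuous_on (points K) p" "continuous_on (points K) q"
    and pm: "\<And>x. x \<in> points K \<Longrightarrow> barycentric (p x)" "\<And>x. x \<in> points K \<Longrightarrow> barycentric (q x)"
    using p q by (auto simp: realization_eq points_def continuous_map_subtopology_eu)
  have *: "continuous_on ({0..1} \<times> points K) (\<lambda>z. f (snd z) v)"
    if "continuous_on (points K) f" for f :: "('a \<Rightarrow> real) \<Rightarrow> ('a \<Rightarrow> real)" and v
    using continuous_on_product_then_coordinatewise[OF that, of v]
    by (intro continuous_on_compose2[OF _ continuous_on_snd[OF continuous_on_id]]) auto
  have "continuous_on ({0..1} \<times> points K) ?h"
    unfolding case_prod_beta
    by (intro continuous_on_coordinatewise_then_product continuous_intros *[OF pc(1)] *[OF pc(2)])
  moreover have "?h \<in> {0..1} \<times> points K \<rightarrow> points L"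
    using convex_combination_points[OF pm(1) pm(2) L pq] by auto
  ultimately have "continuous_map (prod_topology (top_of_set {0..1}) (realization K)) (realization L) ?h"
    by (simp add: realization_eq)
  then show ?thesis
    unfolding homotopic_with_def using P by (intro exI[of _ ?h]) auto
qed

text \<open>The homotopies constructed here move each point inside its fibre of \<open>r\<close>; this is what lets
  them descend to spaces obtained by gluing along \<open>r\<close>.\<close>

lemma strong_collapse_retraction:
  assumes "strong_collapse K L r" "fin_complex K"
  shows "L \<subseteq> K \<and> fin_complex L \<and>
    (\<exists>f. (\<forall>\<sigma>\<in>K. f ` \<sigma> \<in> L) \<and> (\<forall>v\<in>vertices L. f v = v) \<and> (\<forall>v. v \<notin> vertices K \<longrightarrow> f v = v) \<and>
         (\<forall>x\<in>points K. r x = realization_map f x)) \<and>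
    homotopic_with (\<lambda>h. \<forall>x\<in>points K. r (h x) = r x) (realization K) (realization K) id r"
  using assms
proof induction
  case (refl K)
  show ?case
    by (intro conjI refl.prems subset_refl exI[of _ id])
      (auto simp: realization_map_fixes)
next
  case (step K v a L r)
  let ?K' = "delete_vertex K v" and ?g = "id(v := a)"
  let ?\<rho> = "realization_map ?g"
  note K = step.prems
  note K' = fin_complex_delete_vertex[OF K]
  have neq: "a \<noteq> v" using dominated_by_neq[OF step.hyps(1)] .
  have v: "v \<in> vertices K" using step.hyps(1) by (auto simp: dominated_by_def)
  obtain f where f: "\<And>\<sigma>. \<sigma> \<in> ?K' \<Longrightarrow> f ` \<sigma> \<in> L" "\<And>u. u \<in> vertices L \<Longrightarrow> f u = u"
      "\<And>u. u \<notin> vertices ?K' \<Longrightarrow> f u = u" "\<And>x. x \<in> points ?K' \<Longrightarrow> r x = realization_map f x"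
    and L: "L \<subseteq> ?K'" "fin_complex L"
    and hom: "homotopic_with (\<lambda>h. \<forall>x\<in>points ?K'. r (h x) = r x)
      (realization ?K') (realization ?K') id r"
    using step.IH[OF K'] by blast
  have g: "?g ` \<sigma> \<in> ?K'" if "\<sigma> \<in> K" for \<sigma>
    using dominated_by_simplicial[OF K step.hyps(1) that] .
  have \<rho>: "?\<rho> x \<in> points ?K'" if "x \<in> points K" for x
    using realization_map_points[of K ?g ?K' x] g that by blast
  have \<rho>_fix: "?\<rho> x = x" if "x \<in> points ?K'" for x
    using that by (intro realization_map_fixes) (auto simp: points_def supp_def delete_vertex_def)
  have vL: "v \<notin> vertices L" using L(1) by (auto simp: vertices_def delete_vertex_def)
  have rf: "(r \<circ> ?\<rho>) x = realization_map (f \<circ> ?g) x" if "x \<in> points K" for x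
    using f(4)[OF \<rho>[OF that]] that by (simp add: realization_map_comp points_def supp_finite)
  have sub: "points ?K' \<subseteq> points K" by (intro points_mono delete_vertex_subset)
  have cont\<rho>: "continuous_map (realization K) (realization ?K') ?\<rho>"
    using continuous_on_realization_map_points[OF K] \<rho> by (auto simp: realization_eq)
  have incl: "continuous_map (realization ?K') (realization K) id"
    using sub by (auto simp: realization_eq)
  let ?P = "\<lambda>h. \<forall>x\<in>points K. (r \<circ> ?\<rho>) (h x) = (r \<circ> ?\<rho>) x"
  have 1: "homotopic_with ?P (realization K) (realization K) id ?\<rho>"
  proof (rule homotopic_with_convex[OF K])
    show "continuous_map (realization K) (realization K) ?\<rho>"
      using continuous_map_compose[OF cont\<rho> incl] by simp
    show "supp (id x) \<union> supp (?\<rho> x) \<in> K" if x: "x \<in> points K" for x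
    proof (cases "v \<in> supp x")
      case True
      then have "supp x \<union> ?g ` supp x = insert a (supp x)" by auto
      then show ?thesis
        using dominated_by_coface[OF K step.hyps(1) _ True] x
        by (simp add: points_def supp_realization_map)
    next
      case False
      then have "?\<rho> x = x" by (intro realization_map_fixes) (auto simp: supp_def)
      then show ?thesis using x by (simp add: points_def)
    qed
    show "?P (\<lambda>x u. (1 - t) * id x u + t * ?\<rho> x u)" if "t \<in> {0..1}" for t
    proof
      fix x assume x: "x \<in> points K"
      have fin: "finite (supp x)" "finite (supp (?\<rho> x))"
        using x \<rho>[OF x] by (auto simp: points_def intro: supp_finite)
      \<comment> \<open>The segment from \<open>x\<close> to \<open>?\<rho> x\<close> has ends with
        equal image under the idempotent \<open>?\<rho>\<close>, so it stays in one fibre.\<close>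
      have "?\<rho> (\<lambda>u. (1 - t) * x u + t * ?\<rho> x u) = (\<lambda>u. (1 - t) * ?\<rho> x u + t * ?\<rho> (?\<rho> x) u)"
        by (rule realization_map_affine[OF fin])
      also have "\<dots> = ?\<rho> x" using \<rho>_fix[OF \<rho>[OF x]] by (auto simp: algebra_simps)
      finally show "(r \<circ> ?\<rho>) (\<lambda>u. (1 - t) * id x u + t * ?\<rho> x u) = (r \<circ> ?\<rho>) x" by simp
    qed
  qed auto
  \<comment> \<open>The homotopy from the induction hypothesis is precomposed with
    \<open>?\<rho>\<close>. Its stages must be known to map |K'| into itself, because only there
    does the \<open>?\<rho>\<close> applied afterwards act as the identity.\<close>
  let ?Q = "\<lambda>h. (\<forall>x\<in>points ?K'. r (h x) = r x) \<and> (\<forall>x\<in>points ?K'. h x \<in> points ?K')"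
  have "homotopic_with ?Q (realization ?K') (realization ?K') id r"
    by (rule homotopic_with_mono[OF hom]) (auto simp: continuous_map_def)
  then have "homotopic_with ?P (realization K) (realization ?K') (id \<circ> ?\<rho>) (r \<circ> ?\<rho>)"
    by (rule homotopic_with_compose_continuous_map_right[OF _ cont\<rho>]) (auto simp: \<rho> \<rho>_fix)
  then have 2: "homotopic_with ?P (realization K) (realization K) (id \<circ> (id \<circ> ?\<rho>)) (id \<circ> (r \<circ> ?\<rho>))"
    by (rule homotopic_with_compose_continuous_map_left[OF _ incl]) auto
  have "homotopic_with ?P (realization K) (realization K) id (r \<circ> ?\<rho>)"
    using homotopic_with_trans[OF 1] 2 by simp
  moreover have "\<exists>f. (\<forall>\<sigma>\<in>K. f ` \<sigma> \<in> L) \<and> (\<forall>v\<in>vertices L. f v = v) \<and>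
      (\<forall>v. v \<notin> vertices K \<longrightarrow> f v = v) \<and> (\<forall>x\<in>points K. (r \<circ> ?\<rho>) x = realization_map f x)"
  proof (intro exI[of _ "f \<circ> ?g"] conjI ballI allI impI rf)
    show "(f \<circ> ?g) ` \<sigma> \<in> L" if "\<sigma> \<in> K" for \<sigma> 
      unfolding image_comp[symmetric] by (rule f(1)[OF g[OF that]])
    show "(f \<circ> ?g) u = u" if "u \<in> vertices L" for u using that vL f(2)[OF that] by auto
    show "(f \<circ> ?g) u = u" if "u \<notin> vertices K" for u
      using that v f(3)[of u] delete_vertex_subset[of K v] by (auto simp: vertices_def)
  qed
  ultimately show ?case using L delete_vertex_subset[of K v] by blast
qed

lemma strong_collapse_homotopy_equivalent:
  assumes "strong_collapse K L r" "fin_complex K"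
  shows "realization K homotopy_equivalent_space realization L"
proof -
  obtain f where f: "\<And>\<sigma>. \<sigma> \<in> K \<Longrightarrow> f ` \<sigma> \<in> L" "\<And>v. v \<in> vertices L \<Longrightarrow> f v = v"
      "\<And>x. x \<in> points K \<Longrightarrow> r x = realization_map f x"
    and L: "L \<subseteq> K"
    and hom: "homotopic_with (\<lambda>h. \<forall>x\<in>points K. r (h x) = r x) (realization K) (realization K) id r"
    using strong_collapse_retraction[OF assms] by blast
  have "r x \<in> points L" if "x \<in> points K" for x
    using realization_map_points[of K f L x] f that by simp
  then have "continuous_map (realization K) (realization L) r"
    using homotopic_with_imp_continuous_maps[OF hom] by (auto simp: realization_eq)
  moreover have "continuous_map (realization L) (realization K) id"
    using points_mono[OF L] by (auto simp: realization_eq)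
  moreover have "r x = x" if "x \<in> points L" for x
  proof -
    have "realization_map f x = x"
      using that by (intro realization_map_fixes f(2)) (auto simp: points_def supp_def vertices_def)
    then show ?thesis using f(3)[of x] that points_mono[OF L] by auto
  qed
  then have "homotopic_with (\<lambda>x. True) (realization L) (realization L) (r \<circ> id) id"
    by (intro homotopic_with_id2) auto
  moreover have "homotopic_with (\<lambda>x. True) (realization K) (realization K) (id \<circ> r) id"
    using homotopic_with_symD[OF homotopic_with_mono[OF hom, of "\<lambda>x. True"]] by simp
  ultimately show ?thesis unfolding homotopy_equivalent_space_def by blast
qed

section \<open>Collapsing sublevel complexes\<close>

definition delete_vertices :: "'a set set \<Rightarrow> 'a set \<Rightarrow> 'a set set" where
  "delete_vertices K S = {\<sigma> \<in> K. \<sigma> \<inter> S = {}}"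

lemma delete_vertex_delete_vertices:
  "delete_vertex (delete_vertices K S) v = delete_vertices K (insert v S)"
  by (auto simp: delete_vertex_def delete_vertices_def)

lemma fin_complex_delete_vertices: "fin_complex K \<Longrightarrow> fin_complex (delete_vertices K S)"
  by (rule fin_complex_subset[of K]) (auto simp: delete_vertices_def)

text \<open>As long as the apex survives, deleting vertices from a cone leaves a cone over what
  remains of its base.\<close>

lemma dominated_by_delete_vertices:
  assumes K: "fin_complex K" and dom: "dominated_by K v a" and S: "v \<notin> S" "a \<notin> S"
  shows "dominated_by (delete_vertices K S) v a"
proof -
  obtain K0 where K0: "fin_complex K0" "K0 \<subseteq> K" "a \<notin> vertices K0" "link v K = simplicial_cone a K0"
    and v: "v \<in> vertices K"
    using dom by (auto simp: dominated_by_def)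
  have "link v (delete_vertices K S) = delete_vertices (link v K) S"
    using S(1) by (auto simp: link_def delete_vertex_def delete_vertices_def)
  also have "\<dots> = simplicial_cone a (delete_vertices K0 S)"
    using S(2) unfolding K0(4) by (auto simp: simplicial_cone_def delete_vertices_def)
  finally have "link v (delete_vertices K S) = simplicial_cone a (delete_vertices K0 S)" .
  moreover have "v \<in> vertices (delete_vertices K S)"
    using vertex_simplex[OF K v] S(1) by (auto simp: vertices_def delete_vertices_def)
  moreover have "delete_vertices K0 S \<subseteq> delete_vertices K S" "a \<notin> vertices (delete_vertices K0 S)"
    using K0(2,3) by (auto simp: delete_vertices_def vertices_def)
  ultimately show ?thesis
    unfolding dominated_by_def using fin_complex_delete_vertices[OF K0(1)] by blast
qed

lemma fin_complex_sublevel: "fin_complex K \<Longrightarrow> fin_complex (sublevel g K c)"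
  by (rule fin_complex_subset[of K]) (auto simp: sublevel_def)

text \<open>Vertices are deleted in the order of decreasing \<open>g\<close>. Because the dominating vertex of \<open>v\<close> has a
  value strictly below \<open>g v\<close>, it is still present when \<open>v\<close> is deleted, whatever has been removed
  from the level of \<open>v\<close> before.\<close>

lemma strong_collapses_to_delete_vertices:
  assumes K: "fin_complex K" and T: "finite T" "T \<subseteq> vertices K" "T \<inter> R = {}"
    and dom: "\<And>v. v \<in> T \<Longrightarrow> descending_dominated g K v"
    and above: "\<And>u v. \<lbrakk>v \<in> T; u \<in> vertices K; g v < g u\<rbrakk> \<Longrightarrow> u \<in> R \<union> T"
    and R: "\<And>u v. \<lbrakk>u \<in> R; v \<in> T\<rbrakk> \<Longrightarrow> g v \<le> g u"
  shows "strong_collapses_to (delete_vertices K R) (delete_vertices K (R \<union> T))"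
  using T dom above R
proof (induction "card T" arbitrary: T R)
  case 0
  then show ?case using strong_collapse.refl by (auto simp: strong_collapses_to_def)
next
  case (Suc n)
  have ne: "T \<noteq> {}" using Suc.hyps(2) by auto
  have "Max (g ` T) \<in> g ` T" using Suc.prems(1) ne by (intro Max_in) auto
  then obtain v where v: "v \<in> T" "g v = Max (g ` T)" by auto
  have max: "g u \<le> g v" if "u \<in> T" for u using v(2) Suc.prems(1) that by simp
  obtain a where a: "g a < g v" "dominated_by (sublevel g K (g v)) v a"
    using Suc.prems(4)[OF v(1)] by (auto simp: descending_dominated_def)
  have aR: "a \<notin> R" using Suc.prems(6)[of a v] v(1) a(1) by auto
  have vR: "v \<notin> R" using Suc.prems(3) v(1) by blast
  have "g u \<le> g v" if "\<sigma> \<in> K" "\<sigma> \<inter> R = {}" "u \<in> \<sigma>" for \<sigma> u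
  proof (rule ccontr)
    assume less: "\<not> g u \<le> g v"
    moreover have "u \<in> vertices K" using that simplex_subset_vertices by blast
    ultimately have "u \<in> R \<union> T" using Suc.prems(5)[OF v(1), of u] by simp
    then show False using max less that by auto
  qed
  \<comment> \<open>\<open>v\<close> is maximal in \<open>T\<close>, and by the hypothesis on higher
    vertices everything above it is already in \<open>R\<close>. What remains therefore lies in the
    sublevel complex in which \<open>v\<close> is known to be dominated.\<close>
  then have "delete_vertices K R = delete_vertices (sublevel g K (g v)) R"
    by (auto simp: delete_vertices_def sublevel_def)
  then have "dominated_by (delete_vertices K R) v a"
    using dominated_by_delete_vertices[OF fin_complex_sublevel[OF K] a(2) vR aR] by simp
  moreover have "strong_collapses_to (delete_vertices K (insert v R)) (delete_vertices K (insert v R \<union> (T - {v})))"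
  proof (rule Suc.hyps(1))
    show "n = card (T - {v})" using Suc.hyps(2) Suc.prems(1) v(1) by simp
    show "u \<in> insert v R \<union> (T - {v})" if "v' \<in> T - {v}" "u \<in> vertices K" "g v' < g u" for u v'
      using Suc.prems(5)[of v' u] that by auto
    show "g v' \<le> g u" if "u \<in> insert v R" "v' \<in> T - {v}" for u v'
      using Suc.prems(6)[of u v'] that max by auto
  qed (use Suc.prems in auto)
  moreover have "insert v R \<union> (T - {v}) = R \<union> T" using v(1) by auto
  ultimately show ?case
    unfolding strong_collapses_to_def delete_vertex_delete_vertices[symmetric]
    using strong_collapse.step by metis
qed

lemma sublevel_eq_delete_vertices: "sublevel g K c = delete_vertices K {v \<in> vertices K. c < g v}"
  by (auto simp: sublevel_def delete_vertices_def vertices_def not_less disjoint_iff)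

lemma delete_vertex_sublevel:
  "delete_vertex (sublevel g K c) w = delete_vertices K (insert w {v \<in> vertices K. c < g v})"
  unfolding sublevel_eq_delete_vertices delete_vertex_delete_vertices ..

lemma sublevel_strong_collapse:
  assumes K: "fin_complex K" and ab: "a \<le> b"
    and crit: "\<And>v. \<lbrakk>v \<in> vertices K; a < g v; g v \<le> b\<rbrakk> \<Longrightarrow> \<not> strong_critical g K v"
  shows "strong_collapses_to (sublevel g K b) (sublevel g K a)"
proof -
  let ?R = "{v \<in> vertices K. b < g v}" and ?T = "{v \<in> vertices K. a < g v \<and> g v \<le> b}"
  have "strong_collapses_to (delete_vertices K ?R) (delete_vertices K (?R \<union> ?T))"
    using crit finite_vertices[OF K]
    by (intro strong_collapses_to_delete_vertices[where g = g] K) (auto simp: strong_critical_def)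
  moreover have "?R \<union> ?T = {v \<in> vertices K. a < g v}" using ab by auto
  ultimately show ?thesis by (simp add: sublevel_eq_delete_vertices)
qed

text \<open>Here \<open>w\<close> counts as deleted from the start. Other vertices on its level are
  dominated by vertices of strictly smaller value, and such a vertex is never
  \<open>w\<close>.\<close>

lemma punctured_sublevel_strong_collapse:
  assumes K: "fin_complex K" and w: "w \<in> vertices K" "a < g w"
    and crit: "\<And>v. \<lbrakk>v \<in> vertices K; a < g v; g v \<le> g w; v \<noteq> w\<rbrakk> \<Longrightarrow> \<not> strong_critical g K v"
  shows "strong_collapses_to (delete_vertex (sublevel g K (g w)) w) (sublevel g K a)"
proof -
  let ?R = "insert w {v \<in> vertices K. g w < g v}" and ?T = "{v \<in> vertices K. a < g v \<and> g v \<le> g w \<and> v \<noteq> w}"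
  have "strong_collapses_to (delete_vertices K ?R) (delete_vertices K (?R \<union> ?T))"
    using crit finite_vertices[OF K]
    by (intro strong_collapses_to_delete_vertices[where g = g] K) (auto simp: strong_critical_def)
  moreover have "?R \<union> ?T = {v \<in> vertices K. a < g v}" using w by auto
  ultimately show ?thesis
    unfolding delete_vertex_sublevel by (simp add: sublevel_eq_delete_vertices)
qed

section \<open>Polytopes are discs\<close>

lemma continuous_on_Max_image:
  fixes f :: "'i \<Rightarrow> 'c::topological_space \<Rightarrow> real"
  assumes "finite J" "J \<noteq> {}" "\<And>c. c \<in> J \<Longrightarrow> continuous_on S (f c)"
  shows "continuous_on S (\<lambda>z. Max ((\<lambda>c. f c z) ` J))"
  using assms
proof (induction J rule: finite_ne_induct)
  case (insert c J)
  then have "continuous_on S (\<lambda>z. max (f c z) (Max ((\<lambda>c. f c z) ` J)))"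
    by (intro continuous_on_max) auto
  then show ?case using insert.hyps by simp
qed simp

section \<open>Standard discs and spheres, and their compactness\<close>

lemma cdisc_eq: "cdisc n = top_of_set {x. (\<forall>i\<ge>n. x i = 0) \<and> (\<Sum>i<n. (x i)\<^sup>2) \<le> 1}"
  by (simp add: cdisc_def Euclidean_space_def euclidean_product_topology subtopology_subtopology
      Collect_conj_eq)

lemma odisc_eq: "odisc n = subtopology (cdisc n) {x. (\<Sum>i<n. (x i)\<^sup>2) < 1}"
  unfolding odisc_def cdisc_def subtopology_subtopology by (rule arg_cong2[of _ _ _ _ subtopology]) auto

lemma bsphere_eq: "bsphere n = subtopology (cdisc n) {x. (\<Sum>i<n. (x i)\<^sup>2) = 1}"
  unfolding bsphere_def cdisc_def subtopology_subtopology by (rule arg_cong2[of _ _ _ _ subtopology]) auto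

lemma topspace_cdisc: "topspace (cdisc n) = {x. (\<forall>i\<ge>n. x i = 0) \<and> (\<Sum>i<n. (x i)\<^sup>2) \<le> 1}"
  by (simp add: cdisc_eq)

lemma topspace_odisc: "topspace (odisc n) = {x. (\<forall>i\<ge>n. x i = 0) \<and> (\<Sum>i<n. (x i)\<^sup>2) < 1}"
  by (auto simp: odisc_eq topspace_cdisc)

lemma topspace_bsphere: "topspace (bsphere n) = {x. (\<forall>i\<ge>n. x i = 0) \<and> (\<Sum>i<n. (x i)\<^sup>2) = 1}"
  by (auto simp: bsphere_eq topspace_cdisc)

lemma compact_space_cdisc: "compact_space (cdisc n)"
proof -
  let ?C = "{x :: nat \<Rightarrow> real. (\<forall>i\<ge>n. x i = 0) \<and> (\<Sum>i<n. (x i)\<^sup>2) \<le> 1}"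
  have "compactin (powertop_real UNIV) (PiE UNIV (\<lambda>_::nat. {-1..1::real}))"
    by (simp add: compactin_PiE)
  then have "compact (PiE UNIV (\<lambda>_::nat. {-1..1::real}))"
    by (simp add: euclidean_product_topology)
  moreover have "closed ?C"
  proof -
    have "?C = (\<Inter>i\<in>{n..}. {x. x i = 0}) \<inter> {x. (\<Sum>i<n. (x i)\<^sup>2) \<le> 1}" by auto
    moreover have "closed {x :: nat \<Rightarrow> real. x i = 0}" for i
      by (intro closed_Collect_eq continuous_intros)
    moreover have "closed {x :: nat \<Rightarrow> real. (\<Sum>i<n. (x i)\<^sup>2) \<le> 1}"
      by (intro closed_Collect_le continuous_intros)
    ultimately show ?thesis by (simp add: closed_INT closed_Int)
  qed
  ultimately have "compact (PiE UNIV (\<lambda>_::nat. {-1..1::real}) \<inter> ?C)"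
    by (rule compact_Int_closed)
  moreover have "?C \<subseteq> PiE UNIV (\<lambda>_::nat. {-1..1::real})"
  proof
    fix x assume x: "x \<in> ?C"
    have "\<bar>x i\<bar> \<le> 1" for i
    proof (cases "i < n")
      case True
      then have "(x i)\<^sup>2 \<le> (\<Sum>i<n. (x i)\<^sup>2)" by (intro member_le_sum) auto
      then have "(x i)\<^sup>2 \<le> 1" using x by auto
      then show ?thesis by (simp add: abs_square_le_1)
    qed (use x in auto)
    then show "x \<in> PiE UNIV (\<lambda>_::nat. {-1..1::real})"
      by (auto simp: PiE_UNIV_domain abs_le_iff minus_le_iff)
  qed
  ultimately show ?thesis
    by (simp add: cdisc_eq compact_space_subtopology inf.absorb2)
qed

text \<open>\<open>J\<close> lists the coefficient vectors of the inequalities. It includes the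
  coordinate functionals, which place the polytope inside a simplex and hence bound it.
  \<open>b\<close> is an interior point used as centre. Removing the coordinate at \<open>v0\<close>
  and enumerating the others by \<open>e\<close> identifies the affine hull with n-space.\<close>

locale barycentric_polytope =
  fixes V :: "'a set" and J :: "('a \<Rightarrow> real) set" and b :: "'a \<Rightarrow> real"
    and v0 :: 'a and e :: "nat \<Rightarrow> 'a" and n :: nat
  assumes fin: "finite V" "finite J"
    and coord: "\<And>v. v \<in> V \<Longrightarrow> (\<lambda>u. if u = v then 1 else 0) \<in> J"
    and b: "sum b V = 1" "\<And>c. c \<in> J \<Longrightarrow> 0 < (\<Sum>v\<in>V. c v * b v)"
      "\<And>v. v \<notin> V \<Longrightarrow> b v = 0"
    and v0: "v0 \<in> V" and e: "bij_betw e {..<n} (V - {v0})"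
begin

definition ev :: "('a \<Rightarrow> real) \<Rightarrow> ('a \<Rightarrow> real) \<Rightarrow> real" where
  "ev c x = (\<Sum>v\<in>V. c v * x v)"

definition polytope :: "('a \<Rightarrow> real) set" where
  "polytope = {x. (\<forall>v. v \<notin> V \<longrightarrow> x v = 0) \<and> sum x V = 1 \<and> (\<forall>c\<in>J. 0 \<le> ev c x)}"

definition polytope_interior :: "('a \<Rightarrow> real) set" where
  "polytope_interior = {x. (\<forall>v. v \<notin> V \<longrightarrow> x v = 0) \<and> sum x V = 1 \<and> (\<forall>c\<in>J. 0 < ev c x)}"

text \<open>The linear isomorphism from n-space onto the vectors supported on \<open>V\<close> with
  coordinate sum 0; the entry at \<open>v0\<close> balances the others.\<close>

definition dir :: "(nat \<Rightarrow> real) \<Rightarrow> 'a \<Rightarrow> real" where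
  "dir z v = (if v \<in> V - {v0} then z (the_inv_into {..<n} e v)
     else if v = v0 then - (\<Sum>i<n. z i) else 0)"

text \<open>The gauge function of the polytope with respect to the centre \<open>b\<close>. For s
  \<ge> 0 the inequality of \<open>c\<close> at \<open>b + s * dir z\<close> reads
  \<open>s * (- ev c (dir z) / ev c b) \<le> 1\<close>, so the largest of these quotients decides
  how far the ray stays inside.\<close>

definition minkowski :: "(nat \<Rightarrow> real) \<Rightarrow> real" where
  "minkowski z = Max ((\<lambda>c. - ev c (dir z) / ev c b) ` J)"

definition len :: "(nat \<Rightarrow> real) \<Rightarrow> real" where
  "len z = sqrt (\<Sum>i<n. (z i)\<^sup>2)"

text \<open>At \<open>z = 0\<close> the quotient is \<open>0 / 0 = 0\<close>, so that the centre is sent to \<open>b\<close>.\<close>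

definition radial :: "(nat \<Rightarrow> real) \<Rightarrow> 'a \<Rightarrow> real" where
  "radial z v = b v + len z / minkowski z * dir z v"

lemma ev_coord: "v \<in> V \<Longrightarrow> ev (\<lambda>u. if u = v then 1 else 0) x = x v"
  using fin(1) by (simp add: ev_def if_distrib[of "\<lambda>a. a * _"] cong: if_cong)

lemma ev_add_scale: "ev c (\<lambda>v. x v + s * y v) = ev c x + s * ev c y"
  by (simp add: ev_def algebra_simps sum.distrib sum_distrib_left)

lemma ev_scale: "ev c (\<lambda>v. s * y v) = s * ev c y"
  by (simp add: ev_def algebra_simps sum_distrib_left)

lemma ev_b: "c \<in> J \<Longrightarrow> 0 < ev c b"
  using b(2) by (simp add: ev_def)

lemma J_nonempty: "J \<noteq> {}"
  using coord[OF v0] by blast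

lemma dir_e: "i < n \<Longrightarrow> dir z (e i) = z i"
  using e unfolding dir_def bij_betw_def by (auto simp: the_inv_into_f_f)

lemma sum_dir: "sum (dir z) V = 0"
proof -
  have "sum (dir z) (V - {v0}) = (\<Sum>i<n. dir z (e i))"
    by (rule sum.reindex_bij_betw[OF e, symmetric])
  also have "\<dots> = - dir z v0" by (simp add: dir_e) (simp add: dir_def)
  finally show ?thesis using sum.remove[OF fin(1) v0, of "dir z"] by simp
qed

lemma dir_outside: "v \<notin> V \<Longrightarrow> dir z v = 0"
  using v0 by (auto simp: dir_def)

lemma dir_scale: "dir (\<lambda>i. s * z i) = (\<lambda>v. s * dir z v)"
  by (auto simp: dir_def sum_distrib_left)

lemma dir_coords:
  assumes "\<And>v. v \<notin> V \<Longrightarrow> y v = 0" "sum y V = 0"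
  shows "dir (\<lambda>i. if i < n then y (e i) else 0) = y"
proof
  fix v
  show "dir (\<lambda>i. if i < n then y (e i) else 0) v = y v"
  proof (cases "v \<in> V - {v0}")
    case True
    then obtain i where "i < n" "v = e i" using e by (auto simp: bij_betw_def)
    then show ?thesis by (simp add: dir_e)
  next
    case False
    have "(\<Sum>i<n. y (e i)) = sum y (V - {v0})" by (rule sum.reindex_bij_betw[OF e])
    also have "\<dots> = - y v0" using sum.remove[OF fin(1) v0, of y] assms(2) by simp
    finally show ?thesis using False assms(1) by (auto simp: dir_def)
  qed
qed

lemma minkowski_ge: "c \<in> J \<Longrightarrow> - ev c (dir z) / ev c b \<le> minkowski z"
  unfolding minkowski_def using fin(2) by (intro Max_ge) auto

lemma minkowski_attained: obtains c where "c \<in> J" "minkowski z = - ev c (dir z) / ev c b"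
proof -
  have "minkowski z \<in> (\<lambda>c. - ev c (dir z) / ev c b) ` J"
    unfolding minkowski_def using fin(2) J_nonempty by (intro Max_in) auto
  then show thesis using that by blast
qed

lemma b_bounds: assumes "v \<in> V" shows "0 < b v" "b v \<le> 1"
proof -
  have pos: "0 < b u" if "u \<in> V" for u
    using ev_b[OF coord[OF that]] ev_coord[OF that] by simp
  then show "0 < b v" using assms by blast
  have "b v \<le> sum b V" using assms fin pos by (intro member_le_sum) (auto simp: less_imp_le)
  then show "b v \<le> 1" using b by simp
qed

lemma dir_ge_minkowski: "v \<in> V \<Longrightarrow> - dir z v \<le> minkowski z * b v"
  using minkowski_ge[OF coord, of v z] b_bounds(1)[of v] by (simp add: ev_coord field_simps)

text \<open>A negative gauge would make every coordinate of the direction positive, although they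
  sum to 0.\<close>

lemma minkowski_nonneg: "0 \<le> minkowski z"
proof (rule ccontr)
  assume "\<not> 0 \<le> minkowski z"
  then have neg: "minkowski z < 0" by simp
  have "0 < dir z v" if "v \<in> V" for v
    using dir_ge_minkowski[OF that, of z] mult_neg_pos[OF neg b_bounds(1)[OF that]] by linarith
  then have "0 < sum (dir z) V" using fin(1) v0 by (intro sum_pos) auto
  then show False by (simp add: sum_dir)
qed

lemma dir_ge: "v \<in> V \<Longrightarrow> - minkowski z \<le> dir z v"
  using dir_ge_minkowski[of v z] mult_left_mono[OF b_bounds(2)[of v] minkowski_nonneg[of z]] by simp

text \<open>Boundedness of the polytope in quantitative form: each coordinate is at least
  \<open>- minkowski z\<close>, and as they sum to 0 none can be large either. It shows that the
  gauge vanishes only at the origin, and it controls \<open>radial\<close> near the centre.\<close>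

lemma dir_abs_le: "\<bar>dir z v\<bar> \<le> card V * minkowski z"
proof (cases "v \<in> V")
  case True
  have card: "1 \<le> card V" using fin(1) True by (metis One_nat_def Suc_leI card_gt_0_iff empty_iff)
  have "- (\<Sum>u\<in>V - {v}. dir z u) \<le> (\<Sum>u\<in>V - {v}. minkowski z)"
    unfolding sum_negf[symmetric] using dir_ge by (intro sum_mono) (auto simp: minus_le_iff)
  then have "dir z v \<le> (\<Sum>u\<in>V - {v}. minkowski z)"
    using sum.remove[OF fin(1) True, of "dir z"] by (simp add: sum_dir)
  also have "\<dots> \<le> (\<Sum>u\<in>V. minkowski z)" using fin(1) minkowski_nonneg by (intro sum_mono2) auto
  finally have "dir z v \<le> card V * minkowski z" by simp
  moreover have "- dir z v \<le> card V * minkowski z"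
    using dir_ge[OF True, of z] mult_right_mono[of 1 "card V" "minkowski z"] minkowski_nonneg[of z] card by simp
  ultimately show ?thesis by linarith
qed (simp add: dir_outside minkowski_nonneg)

lemma minkowski_eq_0: "minkowski z = 0 \<Longrightarrow> i < n \<Longrightarrow> z i = 0"
  using dir_abs_le[of z "e i"] by (simp add: dir_e)

lemma minkowski_scale: assumes "0 \<le> s" shows "minkowski (\<lambda>i. s * z i) = s * minkowski z"
proof -
  have "mono (\<lambda>a. s * a)" using assms by (auto intro: monoI mult_left_mono)
  then have "s * minkowski z = Max ((\<lambda>a. s * a) ` (\<lambda>c. - ev c (dir z) / ev c b) ` J)"
    unfolding minkowski_def using fin(2) J_nonempty by (intro mono_Max_commute) auto
  then show ?thesis by (simp add: minkowski_def dir_scale ev_scale image_image)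
qed

lemma len_scale: "0 \<le> s \<Longrightarrow> len (\<lambda>i. s * z i) = s * len z"
  by (simp add: len_def power_mult_distrib sum_distrib_left[symmetric] real_sqrt_mult)

lemma len_nonneg: "0 \<le> len z"
  by (simp add: len_def sum_nonneg)

lemma len_eq_0: "len z = 0 \<Longrightarrow> i < n \<Longrightarrow> z i = 0"
  by (simp add: len_def sum_nonneg_eq_0_iff)

lemma len_minkowski: "minkowski z = 0 \<Longrightarrow> len z = 0"
  using minkowski_eq_0[of z] by (simp add: len_def)

lemma minkowski_len: "len z = 0 \<Longrightarrow> minkowski z = 0"
proof -
  assume "len z = 0"
  then have z: "z i = 0" if "i < n" for i using len_eq_0 that by blast
  have "dir z v = 0" for v
  proof (cases "v \<in> V - {v0}")
    case True
    then obtain i where "i < n" "v = e i" using e by (auto simp: bij_betw_def)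
    then show ?thesis by (simp add: dir_e z)
  qed (auto simp: dir_def z)
  then have "dir z = (\<lambda>v. 0)" by auto
  then show ?thesis using minkowski_attained[of z] by (auto simp: ev_def)
qed

lemma ev_radial_less:
  assumes "0 \<le> s"
  shows "(\<forall>c\<in>J. 0 < ev c (\<lambda>v. b v + s * dir z v)) \<longleftrightarrow> s * minkowski z < 1"
proof -
  have *: "0 < ev c (\<lambda>v. b v + s * dir z v) \<longleftrightarrow> s * (- ev c (dir z) / ev c b) < 1" if "c \<in> J" for c
    using ev_b[OF that] by (auto simp: ev_add_scale field_simps)
  obtain c where c: "c \<in> J" "minkowski z = - ev c (dir z) / ev c b" by (rule minkowski_attained)
  have le: "s * (- ev c (dir z) / ev c b) \<le> s * minkowski z" if "c \<in> J" for c
    by (rule mult_left_mono[OF minkowski_ge[OF that] assms])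
  show ?thesis
  proof
    assume "\<forall>c\<in>J. 0 < ev c (\<lambda>v. b v + s * dir z v)"
    then show "s * minkowski z < 1" using *[OF c(1)] c by simp
  next
    assume "s * minkowski z < 1"
    then have "s * (- ev c (dir z) / ev c b) < 1" if "c \<in> J" for c
      by (rule order.strict_trans1[OF le[OF that]])
    then show "\<forall>c\<in>J. 0 < ev c (\<lambda>v. b v + s * dir z v)" using * by blast
  qed
qed

lemma ev_radial_le:
  assumes "0 \<le> s"
  shows "(\<forall>c\<in>J. 0 \<le> ev c (\<lambda>v. b v + s * dir z v)) \<longleftrightarrow> s * minkowski z \<le> 1"
proof -
  have *: "0 \<le> ev c (\<lambda>v. b v + s * dir z v) \<longleftrightarrow> s * (- ev c (dir z) / ev c b) \<le> 1" if "c \<in> J" for c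
    using ev_b[OF that] by (auto simp: ev_add_scale field_simps)
  obtain c where c: "c \<in> J" "minkowski z = - ev c (dir z) / ev c b" by (rule minkowski_attained)
  have le: "s * (- ev c (dir z) / ev c b) \<le> s * minkowski z" if "c \<in> J" for c
    by (rule mult_left_mono[OF minkowski_ge[OF that] assms])
  show ?thesis
  proof
    assume "\<forall>c\<in>J. 0 \<le> ev c (\<lambda>v. b v + s * dir z v)"
    then show "s * minkowski z \<le> 1" using *[OF c(1)] c by simp
  next
    assume "s * minkowski z \<le> 1"
    then have "s * (- ev c (dir z) / ev c b) \<le> 1" if "c \<in> J" for c
      by (rule order.trans[OF le[OF that]])
    then show "\<forall>c\<in>J. 0 \<le> ev c (\<lambda>v. b v + s * dir z v)" using * by blast
  qed
qed

lemma radial_affine: "(v \<notin> V \<longrightarrow> radial z v = 0) \<and> sum (radial z) V = 1"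
proof -
  have "(\<Sum>v\<in>V. len z / minkowski z * dir z v) = 0"
    unfolding sum_distrib_left[symmetric] sum_dir by simp
  then show ?thesis unfolding radial_def sum.distrib by (simp add: b dir_outside)
qed

text \<open>If the gauge is 0, the quotient is 0 by convention, and the second equation survives
  because the norm is 0 as well.\<close>

lemma ratio: "0 \<le> len z / minkowski z" "len z / minkowski z * minkowski z = len z"
  using len_nonneg minkowski_nonneg len_minkowski by (simp, cases "minkowski z = 0") auto

lemma radial_in_polytope: "radial z \<in> polytope \<longleftrightarrow> len z \<le> 1"
  using ev_radial_le[OF ratio(1), of z z] radial_affine ratio(2)[of z]
  unfolding polytope_def radial_def[abs_def] by auto

lemma radial_in_interior: "radial z \<in> polytope_interior \<longleftrightarrow> len z < 1"
  using ev_radial_less[OF ratio(1), of z z] radial_affine ratio(2)[of z]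
  unfolding polytope_interior_def radial_def[abs_def] by auto

lemma radial_surj:
  assumes x: "\<And>v. v \<notin> V \<Longrightarrow> x v = 0" "sum x V = 1"
  shows "\<exists>z. (\<forall>i\<ge>n. z i = 0) \<and> radial z = x"
proof -
  let ?y = "\<lambda>v. x v - b v"
  define y where "y = (\<lambda>i. if i < n then ?y (e i) else 0)"
  have dy: "dir y = ?y" unfolding y_def
    by (rule dir_coords) (auto simp: x b sum_subtractf)
  \<comment> \<open>The quotient of norm and gauge is invariant under scaling, so
    \<open>radial\<close> stretches every point of this ray by the same factor. \<open>s\<close> is
    the inverse of that factor.\<close>
  define s where "s = minkowski y / len y"
  have s: "0 \<le> s" by (simp add: s_def len_nonneg minkowski_nonneg)
  let ?z = "\<lambda>i. s * y i"
  have "len ?z / minkowski ?z * (s * dir y v) = dir y v" for v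
  proof (cases "minkowski y = 0")
    case True
    then have "dir y v = 0" using dir_abs_le[of y v] by simp
    then show ?thesis by simp
  next
    case False
    then have "len y \<noteq> 0" using minkowski_len by blast
    then show ?thesis using False unfolding len_scale[OF s] minkowski_scale[OF s] by (simp add: s_def)
  qed
  then have "radial ?z = x" by (auto simp: radial_def dir_scale dy)
  then show ?thesis by (intro exI[of _ ?z]) (auto simp: y_def)
qed

lemma radial_inj:
  assumes z: "\<And>i. i \<ge> n \<Longrightarrow> z i = 0" and z': "\<And>i. i \<ge> n \<Longrightarrow> z' i = 0"
    and eq: "radial z = radial z'"
  shows "z = z'"
proof -
  let ?s = "len z / minkowski z" and ?s' = "len z' / minkowski z'"
  have "?s * dir z v = ?s' * dir z' v" for v
    using fun_cong[OF eq, of v] by (simp add: radial_def)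
  then have "?s * z i = ?s' * z' i" for i
    using dir_e[of i z] dir_e[of i z'] z[of i] z'[of i] by (metis linorder_not_le mult_zero_right)
  then have eq': "(\<lambda>i. ?s * z i) = (\<lambda>i. ?s' * z' i)" by auto
  \<comment> \<open>Equal images mean equal rescaled vectors. The gauge of the common vector
    recovers the norm of \<open>z\<close> and of \<open>z'\<close>; its norm then recovers the
    scaling factor.\<close>
  have l: "?s * len z = ?s' * len z'"
    using arg_cong[OF eq', of len] by (simp only: len_scale[OF ratio(1)])
  have g: "len z = len z'"
    using arg_cong[OF eq', of minkowski] by (simp only: minkowski_scale[OF ratio(1)] ratio(2))
  show ?thesis
  proof (cases "len z = 0")
    case True
    then have "z i = 0" "z' i = 0" for i
      using g len_eq_0[of z i] len_eq_0[of z' i] z[of i] z'[of i] by (metis linorder_not_le)+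
    then show ?thesis by auto
  next
    case False
    then have "?s = ?s'" using l g by simp
    moreover have "?s \<noteq> 0" using False len_minkowski by auto
    ultimately have "z i = z' i" for i using fun_cong[OF eq', of i] by simp
    then show ?thesis by auto
  qed
qed

lemma continuous_on_dir: "continuous_on S (\<lambda>z. dir z v)"
  unfolding dir_def by (cases "v \<in> V - {v0}"; cases "v = v0") (auto intro!: continuous_intros)

lemma continuous_on_minkowski: "continuous_on S minkowski"
  unfolding minkowski_def[abs_def] ev_def using fin(2) J_nonempty
  by (intro continuous_on_Max_image continuous_intros continuous_on_dir)
    (use ev_b in \<open>fastforce simp: ev_def\<close>)+

lemma continuous_on_len: "continuous_on S len"
  unfolding len_def[abs_def] by (intro continuous_intros)

lemma continuous_on_radial:
  assumes S: "\<And>z i. z \<in> S \<Longrightarrow> i \<ge> n \<Longrightarrow> z i = 0"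
  shows "continuous_on S radial"
proof (rule continuous_on_coordinatewise_then_product)
  fix v
  have "((\<lambda>z. len z / minkowski z * dir z v) \<longlongrightarrow> len x / minkowski x * dir x v) (at x within S)"
    if "x \<in> S" for x
  proof (cases "minkowski x = 0")
    case False
    then show ?thesis
      using that continuous_on_dir[of S v] continuous_on_minkowski[of S] continuous_on_len[of S]
      by (intro tendsto_intros) (auto simp: continuous_on_def)
  next
    case True
    \<comment> \<open>At the centre the quotient of norm and gauge need not converge. The gauge
      cancels against the size of the direction, which leaves a multiple of the norm.\<close>
    have bound: "norm (len z / minkowski z * dir z v) \<le> len z * card V" for z
    proof -
      have "norm (len z / minkowski z * dir z v) = len z / minkowski z * \<bar>dir z v\<bar>"
        by (simp only: real_norm_def abs_mult abs_of_nonneg[OF ratio(1)])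
      also have "\<dots> \<le> len z / minkowski z * (card V * minkowski z)"
        using dir_abs_le ratio(1) by (rule mult_left_mono)
      also have "\<dots> = len z * card V" using ratio(2)[of z] by (metis mult.assoc mult.commute)
      finally show ?thesis .
    qed
    have "((\<lambda>z. len z * card V) \<longlongrightarrow> len x * card V) (at x within S)"
      using that continuous_on_len[of S] by (intro tendsto_intros) (auto simp: continuous_on_def)
    then have lim: "((\<lambda>z. len z * card V) \<longlongrightarrow> 0) (at x within S)"
      using len_minkowski[OF True] by simp
    have "\<forall>\<^sub>F z in at x within S. norm (len z / minkowski z * dir z v) \<le> len z * card V"
      using bound by simp
    then have "((\<lambda>z. len z / minkowski z * dir z v) \<longlongrightarrow> 0) (at x within S)"
      using lim by (rule Lim_null_comparison)
    then show ?thesis using True by simp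
  qed
  then have "continuous_on S (\<lambda>z. len z / minkowski z * dir z v)" by (simp add: continuous_on_def)
  then show "continuous_on S (\<lambda>z. radial z v)"
    unfolding radial_def by (rule continuous_on_add[OF continuous_on_const])
qed

lemma len_le_iff: "len z \<le> 1 \<longleftrightarrow> (\<Sum>i<n. (z i)\<^sup>2) \<le> 1"
  and len_less_iff: "len z < 1 \<longleftrightarrow> (\<Sum>i<n. (z i)\<^sup>2) < 1"
  by (simp_all add: len_def)

lemma polytope_interior_subset: "polytope_interior \<subseteq> polytope"
  by (auto simp: polytope_interior_def polytope_def less_imp_le)

lemma radial_cdisc:
  shows "continuous_map (cdisc n) (top_of_set polytope) radial"
    and "inj_on radial (topspace (cdisc n))"
    and "radial ` topspace (odisc n) = polytope_interior"
    and "radial ` topspace (bsphere n) = polytope - polytope_interior"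
proof -
  show "continuous_map (cdisc n) (top_of_set polytope) radial"
    using continuous_on_radial[of "topspace (cdisc n)"] radial_in_polytope len_le_iff
    by (auto simp: cdisc_eq)
  show "inj_on radial (topspace (cdisc n))"
    by (intro inj_onI radial_inj) (auto simp: topspace_cdisc)
  have surj: "\<exists>z. (\<forall>i\<ge>n. z i = 0) \<and> radial z = x" if "x \<in> polytope" for x
    using that by (intro radial_surj) (auto simp: polytope_def)
  show "radial ` topspace (odisc n) = polytope_interior"
  proof (intro equalityI subsetI)
    fix x assume x: "x \<in> polytope_interior"
    then obtain z where "\<forall>i\<ge>n. z i = 0" "radial z = x" using surj polytope_interior_subset by blast
    then show "x \<in> radial ` topspace (odisc n)"
      using x radial_in_interior[of z] by (intro image_eqI[of _ _ z]) (auto simp: topspace_odisc len_less_iff)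
  qed (auto simp: topspace_odisc radial_in_interior len_less_iff)
  show "radial ` topspace (bsphere n) = polytope - polytope_interior"
  proof (intro equalityI subsetI)
    fix x assume x: "x \<in> polytope - polytope_interior"
    then obtain z where "\<forall>i\<ge>n. z i = 0" "radial z = x" using surj by blast
    then show "x \<in> radial ` topspace (bsphere n)"
      using x radial_in_interior[of z] radial_in_polytope[of z]
      by (intro image_eqI[of _ _ z]) (auto simp: topspace_bsphere len_less_iff len_le_iff)
  qed (auto simp: topspace_bsphere radial_in_interior radial_in_polytope len_less_iff len_le_iff)
qed

end

lemma polytope_cdisc:
  fixes V :: "'a set" and J :: "('a \<Rightarrow> real) set"
  assumes V: "finite V" and J: "finite J"
    and coord: "\<And>v. v \<in> V \<Longrightarrow> (\<lambda>u. if u = v then 1 else 0) \<in> J"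
    and D: "D = {x. (\<forall>v. v \<notin> V \<longrightarrow> x v = 0) \<and> sum x V = 1 \<and> (\<forall>c\<in>J. 0 \<le> (\<Sum>v\<in>V. c v * x v))}"
    and D0: "D0 = {x. (\<forall>v. v \<notin> V \<longrightarrow> x v = 0) \<and> sum x V = 1 \<and> (\<forall>c\<in>J. 0 < (\<Sum>v\<in>V. c v * x v))}"
    and ne: "D0 \<noteq> {}"
  obtains h where "continuous_map (cdisc (card V - 1)) (top_of_set D) h"
    "inj_on h (topspace (cdisc (card V - 1)))"
    "h ` topspace (odisc (card V - 1)) = D0" "h ` topspace (bsphere (card V - 1)) = D - D0"
proof -
  obtain b where b: "b \<in> D0" using ne by blast
  then have "V \<noteq> {}" by (auto simp: D0)
  then obtain v0 where v0: "v0 \<in> V" by blast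
  have "card (V - {v0}) = card V - 1" using V v0 by simp
  then obtain e where e: "bij_betw e {..<card V - 1} (V - {v0})"
    using ex_bij_betw_nat_finite[of "V - {v0}"] V by (auto simp: atLeast0LessThan)
  interpret barycentric_polytope V J b v0 e "card V - 1"
    using V J coord b v0 e by unfold_locales (auto simp: D0)
  have "D = polytope" "D0 = polytope_interior"
    by (simp_all add: D D0 polytope_def polytope_interior_def ev_def)
  then show thesis using radial_cdisc that by simp
qed

section \<open>Pushouts\<close>

lemma topspace_disjoint_union:
  "(t, x) \<in> topspace (disjoint_union X Y) \<longleftrightarrow> x \<in> topspace (if t then X else Y)"
  by (simp add: disjoint_union_def)

lemma topspace_pushout:
  "topspace (pushout C X Y i f) = topspace (disjoint_union X Y) // glue_rel C X Y i f"
proof -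
  let ?T = "topspace (disjoint_union X Y)" and ?R = "glue_rel C X Y i f"
  note eq = equiv_glue_rel[of X Y C i f]
  have "openin (pushout C X Y i f) (?T // ?R)"
    using Union_quotient[OF eq] by (simp add: pushout_def openin_quotient_topology[OF eq])
  then show ?thesis
    using openin_quotient_topology[OF eq] unfolding pushout_def
    by (meson openin_subset openin_topspace subset_antisym)
qed

lemma pushout_in1_in_quotient:
  "x \<in> topspace X \<Longrightarrow> pushout_in1 C X Y i f x \<in> topspace (pushout C X Y i f)"
  unfolding topspace_pushout pushout_in1_def by (rule quotientI) (simp add: topspace_disjoint_union)

lemma pushout_in2_in_quotient:
  "y \<in> topspace Y \<Longrightarrow> pushout_in2 C X Y i f y \<in> topspace (pushout C X Y i f)"
  unfolding topspace_pushout pushout_in2_def by (rule quotientI) (simp add: topspace_disjoint_union)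

lemma topspace_pushout_cases:
  assumes "u \<in> topspace (pushout C X Y i f)"
  obtains x where "x \<in> topspace X" "u = pushout_in1 C X Y i f x"
    | y where "y \<in> topspace Y" "u = pushout_in2 C X Y i f y"
proof -
  from assms obtain t x where tx: "(t, x) \<in> topspace (disjoint_union X Y)"
      "u = glue_rel C X Y i f `` {(t, x)}"
    unfolding topspace_pushout by (auto elim!: quotientE)
  show thesis
  proof (cases t)
    case True
    then show thesis using that(1)[of x] tx by (simp add: topspace_disjoint_union pushout_in1_def)
  next
    case False
    then show thesis using that(2)[of x] tx by (simp add: topspace_disjoint_union pushout_in2_def)
  qed
qed

lemma mem_Union_quotient:
  assumes eq: "equiv T R" and U: "U \<subseteq> T // R" and p: "p \<in> T"
  shows "p \<in> \<Union>U \<longleftrightarrow> R `` {p} \<in> U"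
proof
  assume "p \<in> \<Union>U"
  then obtain u where u: "u \<in> U" "p \<in> u" by blast
  then have "R `` {p} = u"
    using U eq p by (metis Image_singleton_iff equiv_class_eq_iff quotientE subsetD)
  then show "R `` {p} \<in> U" using u by simp
next
  assume "R `` {p} \<in> U"
  then show "p \<in> \<Union>U" using equiv_class_self[OF eq p] by blast
qed

lemma openin_pushout:
  "openin (pushout C X Y i f) U \<longleftrightarrow> U \<subseteq> topspace (pushout C X Y i f) \<and>
     openin X {x \<in> topspace X. pushout_in1 C X Y i f x \<in> U} \<and>
     openin Y {y \<in> topspace Y. pushout_in2 C X Y i f y \<in> U}"
proof -
  let ?T = "topspace (disjoint_union X Y)" and ?R = "glue_rel C X Y i f"
  note eq = equiv_glue_rel[of X Y C i f]
  have "openin (disjoint_union X Y) (\<Union>U) \<longleftrightarrow>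
     openin X {x \<in> topspace X. pushout_in1 C X Y i f x \<in> U} \<and>
     openin Y {y \<in> topspace Y. pushout_in2 C X Y i f y \<in> U}" if U: "U \<subseteq> ?T // ?R"
  proof -
    have sub: "\<Union>U \<subseteq> ?T" using U Union_quotient[OF eq] by blast
    have "{x. (t, x) \<in> \<Union>U} = {x \<in> topspace (if t then X else Y). ?R `` {(t, x)} \<in> U}" for t
      using mem_Union_quotient[OF eq U] sub by (auto simp: topspace_disjoint_union[symmetric])
    then show ?thesis
      using sub unfolding pushout_in1_def pushout_in2_def disjoint_union_def
      by (simp add: openin_sum_topology UNIV_bool conj_commute)
  qed
  then show ?thesis
    unfolding topspace_pushout by (auto simp: pushout_def openin_quotient_topology[OF eq])
qed

lemma continuous_map_pushout_in1: "continuous_map X (pushout C X Y i f) (pushout_in1 C X Y i f)"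
  by (auto simp: continuous_map_def pushout_in1_in_quotient openin_pushout)

lemma continuous_map_from_pushout:
  assumes "continuous_map X Z (h \<circ> pushout_in1 C X Y i f)"
    and "continuous_map Y Z (h \<circ> pushout_in2 C X Y i f)"
  shows "continuous_map (pushout C X Y i f) Z h"
  unfolding continuous_map_def
proof (intro conjI allI impI)
  show "h \<in> topspace (pushout C X Y i f) \<rightarrow> topspace Z"
    using assms by (auto simp: continuous_map_def elim!: topspace_pushout_cases)
  fix W assume W: "openin Z W"
  have "{x \<in> topspace X. (h \<circ> pushout_in1 C X Y i f) x \<in> W} =
      {x \<in> topspace X. pushout_in1 C X Y i f x \<in> {u \<in> topspace (pushout C X Y i f). h u \<in> W}}"
    and "{y \<in> topspace Y. (h \<circ> pushout_in2 C X Y i f) y \<in> W} =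
      {y \<in> topspace Y. pushout_in2 C X Y i f y \<in> {u \<in> topspace (pushout C X Y i f). h u \<in> W}}"
    by (auto simp: pushout_in1_in_quotient pushout_in2_in_quotient)
  then have "openin X {x \<in> topspace X. pushout_in1 C X Y i f x \<in> {u \<in> topspace (pushout C X Y i f). h u \<in> W}}"
    and "openin Y {y \<in> topspace Y. pushout_in2 C X Y i f y \<in> {u \<in> topspace (pushout C X Y i f). h u \<in> W}}"
    using openin_continuous_map_preimage[OF assms(1) W] openin_continuous_map_preimage[OF assms(2) W]
    by simp_all
  then show "openin (pushout C X Y i f) {u \<in> topspace (pushout C X Y i f). h u \<in> W}"
    unfolding openin_pushout by blast
qed

text \<open>Replacing each point of \<open>C\<close> by its image in \<open>Y\<close> is a normal
  form. Generating pairs share it, and every element is related to its own normal form by at most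
  one step, so the generated equivalence is equality of normal forms.\<close>

lemma glue_rel_id:
  assumes C: "topspace C \<subseteq> topspace X" and f: "f ` topspace C \<subseteq> topspace Y"
    and p: "p \<in> topspace (disjoint_union X Y)" "p' \<in> topspace (disjoint_union X Y)"
    and nf: "nf = (\<lambda>(t, x). if t \<and> x \<in> topspace C then (False, f x) else (t, x))"
  shows "(p, p') \<in> glue_rel C X Y id f \<longleftrightarrow> nf p = nf p'"
proof -
  define S where "S = {((True, id c), (False, f c)) |c. c \<in> topspace C}"
  have sym: "sym ((S \<union> S\<inverse>)\<^sup>*)" by (intro sym_rtrancl) (auto simp: sym_def)
  have inv: "nf a = nf b" if "(a, b) \<in> (S \<union> S\<inverse>)\<^sup>*" for a b
    using that by (induction rule: rtrancl_induct) (auto simp: S_def nf)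
  have to_nf: "(a, nf a) \<in> (S \<union> S\<inverse>)\<^sup>*" for a
    by (cases a) (auto simp: S_def nf)
  have "(a, b) \<in> (S \<union> S\<inverse>)\<^sup>*" if "nf a = nf b" for a b
    using to_nf[of a] to_nf[of b] that sym by (metis rtrancl_trans symD)
  then have "(p, p') \<in> (S \<union> S\<inverse>)\<^sup>* \<longleftrightarrow> nf p = nf p'" using inv by blast
  then show ?thesis using p by (simp add: glue_rel_def Let_def S_def)
qed

lemma pushout_in1_eq_iff:
  assumes C: "topspace C \<subseteq> topspace X" and f: "f ` topspace C \<subseteq> topspace Y"
    and x: "x \<in> topspace X" "x' \<in> topspace X"
  shows "pushout_in1 C X Y id f x = pushout_in1 C X Y id f x' \<longleftrightarrow>
    x = x' \<or> (x \<in> topspace C \<and> x' \<in> topspace C \<and> f x = f x')"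
proof -
  have T: "(True, x) \<in> topspace (disjoint_union X Y)" "(True, x') \<in> topspace (disjoint_union X Y)"
    using x by (simp_all add: topspace_disjoint_union)
  show ?thesis
    unfolding pushout_in1_def eq_equiv_class_iff[OF equiv_glue_rel T] glue_rel_id[OF C f T HOL.refl]
    by auto
qed

lemma pushout_in2_eq_in1:
  assumes C: "topspace C \<subseteq> topspace X" and f: "f ` topspace C \<subseteq> topspace Y" and x: "x \<in> topspace C"
  shows "pushout_in2 C X Y id f (f x) = pushout_in1 C X Y id f x"
proof -
  have T: "(False, f x) \<in> topspace (disjoint_union X Y)" "(True, x) \<in> topspace (disjoint_union X Y)"
    using x C f by (auto simp: topspace_disjoint_union)
  show ?thesis
    unfolding pushout_in1_def pushout_in2_def eq_equiv_class_iff[OF equiv_glue_rel T]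
      glue_rel_id[OF C f T HOL.refl]
    using x by auto
qed

lemma quotient_map_factor:
  assumes q: "quotient_map X A q" and k: "continuous_map X Z k"
    and eq: "\<And>x y. \<lbrakk>x \<in> topspace X; y \<in> topspace X; q x = q y\<rbrakk> \<Longrightarrow> k x = k y"
  shows "\<exists>g. continuous_map A Z g \<and> (\<forall>x\<in>topspace X. g (q x) = k x)"
  by (rule quotient_map_lift_exists[OF q k eq]) auto

text \<open>The end \<open>k\<close> of the homotopy is constant on the fibres of \<open>q\<close>,
  so it factors through \<open>A\<close>, and the factor \<open>k'\<close> is the homotopy inverse
  of \<open>q\<close>. Intermediate stages only need to respect fibres after applying
  \<open>q\<close>, which is enough to push the homotopy down to \<open>A\<close>.\<close>

lemma quotient_homotopy_equivalent:
  assumes X: "compact_space X" and A: "Hausdorff_space A" and q: "quotient_map X A q"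
    and hom: "homotopic_with
      (\<lambda>h. \<forall>x\<in>topspace X. \<forall>y\<in>topspace X. q x = q y \<longrightarrow> q (h x) = q (h y)) X X id k"
    and k: "\<And>x y. \<lbrakk>x \<in> topspace X; y \<in> topspace X; q x = q y\<rbrakk> \<Longrightarrow> k x = k y"
  shows "X homotopy_equivalent_space A"
proof -
  let ?I = "top_of_set {0..1::real}"
  have qc: "continuous_map X A q" and qs: "q ` topspace X = topspace A"
    using q quotient_imp_continuous_map quotient_imp_surjective_map by blast+
  have kc: "continuous_map X X k" using homotopic_with_imp_continuous_maps[OF hom] by blast
  obtain k' where k': "continuous_map A X k'" "\<And>x. x \<in> topspace X \<Longrightarrow> k' (q x) = k x"
    using quotient_map_factor[OF q kc k] by blast
  obtain H where H: "continuous_map (prod_topology ?I X) X H"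
      "\<And>x. H (0, x) = x" "\<And>x. H (1, x) = k x"
    and Hq: "\<And>t x y. \<lbrakk>t \<in> {0..1}; x \<in> topspace X; y \<in> topspace X; q x = q y\<rbrakk> \<Longrightarrow> q (H (t, x)) = q (H (t, y))"
    using hom unfolding homotopic_with_def id_def by blast
  let ?Q = "\<lambda>z. (fst z :: real, q (snd z))"
  \<comment> \<open>Products of quotient maps are not quotient maps in general; here the source is
    compact and the target Hausdorff.\<close>
  have Q: "quotient_map (prod_topology ?I X) (prod_topology ?I A) ?Q"
  proof (rule T1_Spaces.continuous_imp_quotient_map)
    show "continuous_map (prod_topology ?I X) (prod_topology ?I A) ?Q"
      using continuous_map_compose[OF continuous_map_snd qc]
      by (simp add: continuous_map_paired continuous_map_fst o_def)
    show "compact_space (prod_topology ?I X)"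
      by (simp add: compact_space_prod_topology X compact_space_subtopology)
    show "Hausdorff_space (prod_topology ?I A)"
      by (simp add: Hausdorff_space_prod_topology A Hausdorff_space_subtopology)
    show "?Q ` topspace (prod_topology ?I X) = topspace (prod_topology ?I A)"
      using qs by (force simp: image_iff)
  qed
  have HQ: "(q \<circ> H) z = (q \<circ> H) z'" if "z \<in> topspace (prod_topology ?I X)"
      "z' \<in> topspace (prod_topology ?I X)" "?Q z = ?Q z'" for z z'
    using that Hq[of "fst z" "snd z" "snd z'"] by (cases z; cases z') auto
  obtain F where F: "continuous_map (prod_topology ?I A) A F"
    and Fq: "\<And>z. z \<in> topspace (prod_topology ?I X) \<Longrightarrow> F (?Q z) = (q \<circ> H) z"
    using quotient_map_factor[OF Q continuous_map_compose[OF H(1) qc] HQ] by blast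
  have Fq': "F (t, q x) = q (H (t, x))" if "t \<in> {0..1}" "x \<in> topspace X" for t x
    using Fq[of "(t, x)"] that by simp
  have "homotopic_with (\<lambda>x. True) A A id (q \<circ> k')"
  proof (subst homotopic_with, simp, intro exI[of _ F] conjI ballI F)
    fix u assume "u \<in> topspace A"
    then obtain x where x: "x \<in> topspace X" "u = q x" using qs by auto
    show "F (0, u) = id u" using x by (simp add: Fq' H)
    show "F (1, u) = (q \<circ> k') u" using x by (simp add: Fq' H k')
  qed simp
  moreover have "homotopic_with (\<lambda>x. True) X X (k' \<circ> q) id"
  proof (rule homotopic_with_symD, rule homotopic_with_eq)
    show "homotopic_with (\<lambda>x. True) X X id k" using hom by (rule homotopic_with_mono) simp
  qed (auto simp: k')
  ultimately show ?thesis
    unfolding homotopy_equivalent_space_def using qc k'(1) homotopic_with_symD by blast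
qed

section \<open>Attaching an open star along a retraction of the deletion\<close>

text \<open>What is retained of a strong collapse from \<open>L - w\<close> to \<open>M\<close>: the
  vertex map \<open>f\<close> behind \<open>r\<close>, and a homotopy whose stages preserve the
  fibres of \<open>r\<close>. Fixing the vertices outside the deletion extends \<open>f\<close> to
  \<open>w\<close>.\<close>

locale star_attachment =
  fixes L M :: "'a set set" and w :: 'a and r :: "('a \<Rightarrow> real) \<Rightarrow> 'a \<Rightarrow> real" and f :: "'a \<Rightarrow> 'a"
  assumes L: "fin_complex L" and M: "M \<subseteq> delete_vertex L w" "fin_complex M"
    and f_simplicial: "\<And>\<sigma>. \<sigma> \<in> delete_vertex L w \<Longrightarrow> f ` \<sigma> \<in> M"
    and f_fixes: "\<And>v. v \<in> vertices M \<Longrightarrow> f v = v"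
    and f_outside: "\<And>v. v \<notin> vertices (delete_vertex L w) \<Longrightarrow> f v = v"
    and r_eq: "\<And>x. x \<in> points (delete_vertex L w) \<Longrightarrow> r x = realization_map f x"
    and r_homotopic: "homotopic_with (\<lambda>h. \<forall>x\<in>points (delete_vertex L w). r (h x) = r x)
      (realization (delete_vertex L w)) (realization (delete_vertex L w)) id r"
begin

abbreviation C :: "'a set set" where "C \<equiv> delete_vertex L w"

definition q :: "('a \<Rightarrow> real) \<Rightarrow> (bool \<times> ('a \<Rightarrow> real)) set" where
  "q = pushout_in1 (realization C) (realization L) (realization M) id r"

definition A :: "(bool \<times> ('a \<Rightarrow> real)) set topology" where
  "A = attach_space L w M r"

lemma points_C: "x \<in> points C \<longleftrightarrow> x \<in> points L \<and> x w = 0"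
  by (auto simp: points_def delete_vertex_def supp_def)

lemma points_C_subset: "points C \<subseteq> points L"
  using points_C by blast

lemma points_M_subset: "points M \<subseteq> points C"
  by (rule points_mono[OF M(1)])

lemma r_points: "x \<in> points C \<Longrightarrow> r x \<in> points M"
  using realization_map_points[OF f_simplicial] r_eq by simp

lemma r_fixes: "x \<in> points M \<Longrightarrow> r x = x"
proof -
  assume x: "x \<in> points M"
  then have "realization_map f x = x"
    by (intro realization_map_fixes f_fixes) (auto simp: points_def supp_def vertices_def)
  then show "r x = x" using r_eq x points_M_subset by auto
qed

lemma f_w: "f w = w"
  by (rule f_outside) (auto simp: vertices_def delete_vertex_def)

text \<open>Vertices of the deletion are sent into \<open>M\<close>, which avoids \<open>w\<close>.
  So \<open>w\<close> is alone in its fibre, and \<open>realization_map f\<close> keeps the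
  coordinate at \<open>w\<close>.\<close>

lemma f_eq_w: "f v = w \<longleftrightarrow> v = w"
proof
  assume v: "f v = w"
  show "v = w"
  proof (cases "v \<in> vertices C")
    case True
    then have "{f v} \<in> M"
      using f_simplicial[OF vertex_simplex[OF fin_complex_delete_vertex[OF L] True]] by simp
    then show ?thesis using M v by (auto simp: delete_vertex_def)
  qed (use f_outside v in auto)
qed (simp add: f_w)

lemma realization_map_f_w: "realization_map f x w = x w"
proof -
  have "{v. x v \<noteq> 0 \<and> f v = w} = (if x w = 0 then {} else {w})" by (auto simp: f_eq_w)
  then show ?thesis by (simp add: realization_map_def)
qed

lemma q_eq_iff:
  assumes "x \<in> points L" "x' \<in> points L"
  shows "q x = q x' \<longleftrightarrow> x = x' \<or> (x w = 0 \<and> x' w = 0 \<and> r x = r x')"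
  unfolding q_def using assms points_C points_C_subset r_points
  by (subst pushout_in1_eq_iff) auto

text \<open>A point of |M| is fixed by \<open>r\<close>, hence glued to its own copy in |L|. This
  makes \<open>q\<close> surjective.\<close>

lemma in2_eq_q:
  assumes "y \<in> points M"
  shows "pushout_in2 (realization C) (realization L) (realization M) id r y = q y"
  using pushout_in2_eq_in1[of "realization C" "realization L" r "realization M" y]
    assms points_M_subset points_C_subset r_points r_fixes
  unfolding q_def by (auto simp: image_subset_iff)

lemma q_continuous: "continuous_map (realization L) A q"
  unfolding A_def attach_space_def q_def by (rule continuous_map_pushout_in1)

lemma topspace_A: "topspace A = q ` points L"
proof (intro equalityI subsetI)
  fix u assume "u \<in> topspace A"
  then show "u \<in> q ` points L"
    unfolding A_def attach_space_def
  proof (cases rule: topspace_pushout_cases)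
    case (2 y)
    then have "u = q y" "y \<in> points L" using in2_eq_q points_M_subset points_C_subset by auto
    then show ?thesis by blast
  qed (auto simp: q_def)
qed (use continuous_map_image_subset_topspace[OF q_continuous] in auto)

text \<open>The second block of coordinates is multiplied by \<open>x w\<close>, so that it separates the points of the
  open star of \<open>w\<close> and vanishes where the gluing takes place.\<close>

definition embedding_coords :: "('a \<Rightarrow> real) \<Rightarrow> bool \<times> 'a \<Rightarrow> real" where
  "embedding_coords x = (\<lambda>(t, v). if t then realization_map f x v else x w * x v)"

lemma embedding_coords_eq_iff:
  assumes x: "x \<in> points L" "x' \<in> points L"
  shows "embedding_coords x = embedding_coords x' \<longleftrightarrow> q x = q x'"
proof
  assume "q x = q x'"
  then consider "x = x'" | "x w = 0" "x' w = 0" "r x = r x'" using q_eq_iff[OF x] by blast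
  then show "embedding_coords x = embedding_coords x'"
  proof cases
    case 2
    then have "realization_map f x = realization_map f x'"
      using x points_C r_eq by metis
    then show ?thesis using 2 by (auto simp: embedding_coords_def)
  qed simp
next
  assume eq: "embedding_coords x = embedding_coords x'"
  have m: "realization_map f x v = realization_map f x' v" for v
    using fun_cong[OF eq, of "(True, v)"] by (simp add: embedding_coords_def)
  have s: "x w * x v = x' w * x' v" for v
    using fun_cong[OF eq, of "(False, v)"] by (simp add: embedding_coords_def)
  have w: "x w = x' w" using m[of w] realization_map_f_w x by simp
  show "q x = q x'"
  proof (cases "x w = 0")
    case True
    then have "r x = r x'" using w x points_C r_eq m by fastforce
    then show ?thesis using True w q_eq_iff[OF x] by simp
  next
    case False
    then have "x v = x' v" for v using s[of v] w by simp
    then show ?thesis by (metis ext)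
  qed
qed

lemma continuous_embedding_coords: "continuous_map (realization L) euclidean embedding_coords"
proof -
  have "continuous_on (points L) (\<lambda>x. embedding_coords x (t, v))" for t v
    using continuous_on_product_then_coordinatewise[OF continuous_on_realization_map_points[OF L, of f], of v]
    by (cases t) (auto simp: embedding_coords_def intro!: continuous_intros)
  then have "continuous_on (points L) embedding_coords"
    by (intro continuous_on_coordinatewise_then_product) auto
  then show ?thesis by (simp add: realization_eq)
qed

text \<open>\<open>embedding_coords\<close> takes the same value on two points exactly when
  \<open>q\<close> identifies them, so it descends to a continuous injection of \<open>A\<close>
  into a product of lines.\<close>

lemma Hausdorff_A: "Hausdorff_space A"
proof -
  define h where "h u = embedding_coords (SOME x. x \<in> points L \<and> q x = u)" for u
  have h: "h (q x) = embedding_coords x" if "x \<in> points L" for x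
  proof -
    have "(SOME x'. x' \<in> points L \<and> q x' = q x) \<in> points L \<and> q (SOME x'. x' \<in> points L \<and> q x' = q x) = q x"
      by (rule someI[where x = x]) (use that in simp)
    then show ?thesis unfolding h_def using embedding_coords_eq_iff that by blast
  qed
  have "continuous_map A euclidean h"
    unfolding A_def attach_space_def
  proof (rule continuous_map_from_pushout, fold q_def)
    show "continuous_map (realization L) euclidean (h \<circ> q)"
      by (rule continuous_map_eq[OF continuous_embedding_coords]) (simp add: h)
    have "continuous_map (realization M) euclidean embedding_coords"
      using continuous_map_from_subtopology[OF continuous_embedding_coords]
        realization_subtopology[of M L] M delete_vertex_subset by (metis subset_trans)
    then show "continuous_map (realization M) euclidean
        (h \<circ> pushout_in2 (realization C) (realization L) (realization M) id r)"
      by (rule continuous_map_eq) (use h in2_eq_q points_M_subset points_C_subset in auto)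
  qed
  moreover have "inj_on h (topspace A)"
    by (auto simp: inj_on_def topspace_A h embedding_coords_eq_iff)
  ultimately show ?thesis
    using Hausdorff_space_injective_preimage[OF Hausdorff_fun] by blast
qed

lemma q_quotient_map: "quotient_map (realization L) A q"
  by (rule T1_Spaces.continuous_imp_quotient_map)
    (simp_all add: q_continuous compact_space_realization L Hausdorff_A topspace_A)

text \<open>The homotopy from the identity to \<open>r\<close> on the deletion is extended to the open star of \<open>w\<close> by
  running it for a shorter and shorter time as the coordinate \<open>x w\<close> grows from \<open>0\<close> to \<open>t / 2\<close>;
  beyond \<open>t / 2\<close> the cone with apex \<open>w\<close> is stretched linearly.\<close>

lemma cone_extension:
  "\<exists>k. homotopic_with
      (\<lambda>h. \<forall>x\<in>points L. \<forall>y\<in>points L. q x = q y \<longrightarrow> q (h x) = q (h y)) (realization L) (realization L) id k \<and>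
     (\<forall>x\<in>points C. k x = r x)"
proof -
  obtain H where H: "continuous_map (prod_topology (top_of_set {0..1::real}) (realization C)) (realization C) H"
    and H01: "\<And>x. H (0, x) = x" "\<And>x. H (1, x) = r x"
    and Hr: "\<And>t x. \<lbrakk>t \<in> {0..1}; x \<in> points C\<rbrakk> \<Longrightarrow> r (H (t, x)) = r x"
    using r_homotopic unfolding homotopic_with_def id_def by blast
  have Hc: "continuous_on ({0..1} \<times> points C) H" and HC: "\<And>t x. \<lbrakk>t \<in> {0..1}; x \<in> points C\<rbrakk> \<Longrightarrow> H (t, x) \<in> points C"
    using H by (auto simp: realization_eq)
  \<comment> \<open>The projection from the apex \<open>w\<close> onto the base of the cone. In
    \<open>G\<close> it is applied only where \<open>x w \<le> 1/2\<close>, away from the zero of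
    the denominator.\<close>
  define p where "p x = (\<lambda>v. if v = w then 0 else x v / (1 - x w))" for x :: "'a \<Rightarrow> real"
  \<comment> \<open>The constants send the coordinate at \<open>w\<close> affinely from [t/2, 1]
    onto [0, 1]. At \<open>x w = t / 2\<close> the result is \<open>p x\<close>, which agrees with
    the start \<open>H (0, p x)\<close> of the other branch; at t = 0 it is the identity.\<close>
  define st where "st t x = (\<lambda>v. if v = w then 1 - (1 - x w) * 2 / (2 - t) else x v * 2 / (2 - t))"
    for t :: real and x :: "'a \<Rightarrow> real"
  define G where "G = (\<lambda>(t, x). if 2 * x w \<le> t then H (t - 2 * x w, p x) else st t x)"
  let ?S = "{0..1::real} \<times> points L"
  have nonneg: "0 \<le> x v" and le1: "x v \<le> 1" if "x \<in> points L" for x v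
    using that barycentric_le_1[of x v] by (simp_all add: points_def) (simp add: barycentric_def)
  have pC: "p x \<in> points C" if x: "x \<in> points L" "x w < 1" for x
  proof -
    have b: "barycentric x" and s: "supp x \<in> L" using x by (auto simp: points_def)
    note fin = supp_finite[OF b]
    have sub: "supp (p x) \<subseteq> supp x" by (auto simp: supp_def p_def)
    have "sum x (supp x - {w}) = 1 - x w"
      using barycentric_sum[OF b fin subset_refl] fin by (cases "w \<in> supp x") (auto simp: sum_diff1 supp_def)
    moreover have "sum (p x) (supp x) = (\<Sum>v\<in>supp x - {w}. x v / (1 - x w))"
      using fin by (intro sum.mono_neutral_cong_right) (auto simp: p_def)
    ultimately have "sum (p x) (supp x) = 1" using x by (simp add: sum_divide_distrib[symmetric])
    then have bp: "barycentric (p x)"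
      using fin sub nonneg[OF x(1)] x(2) by (intro barycentricI[of "supp x"]) (auto simp: p_def)
    then have "p x \<in> points L"
      using fin_complex_face[OF L s sub supp_nonempty[OF bp]] by (simp add: points_def)
    then show ?thesis unfolding points_C by (simp add: p_def)
  qed
  have stL: "st t x \<in> points L" if x: "x \<in> points L" and t: "t \<in> {0..1}" "t \<le> 2 * x w" for t x
  proof -
    have b: "barycentric x" and s: "supp x \<in> L" using x by (auto simp: points_def)
    let ?V = "insert w (supp x)"
    have fin: "finite ?V" using supp_finite[OF b] by simp
    have 1: "sum x (?V - {w}) = 1 - x w"
      using barycentric_sum[OF b fin subset_insertI] sum.remove[OF fin, of w x] by simp
    have "sum (st t x) ?V = st t x w + sum (st t x) (?V - {w})"
      using fin by (intro sum.remove) auto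
    also have "sum (st t x) (?V - {w}) = (\<Sum>v\<in>?V - {w}. x v * (2 / (2 - t)))"
      by (intro sum.cong) (auto simp: st_def)
    also have "\<dots> = (1 - x w) * (2 / (2 - t))" using 1 by (simp only: sum_distrib_right[symmetric])
    finally have "sum (st t x) ?V = 1" by (simp add: st_def)
    moreover have nn: "0 \<le> st t x v" for v
      using t nonneg[OF x] by (auto simp: st_def divide_simps)
    ultimately have bs: "barycentric (st t x)"
      using fin by (intro barycentricI[of ?V]) (auto simp: st_def supp_def)
    have "supp (st t x) \<subseteq> supp x"
      using t le1[OF x, of w] nonneg[OF x, of w] by (auto simp: supp_def st_def field_simps)
    then show ?thesis
      using fin_complex_face[OF L s _ supp_nonempty[OF bs]] bs by (simp add: points_def)
  qed
  have GL: "G (t, x) \<in> points L" if "t \<in> {0..1}" "x \<in> points L" for t x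
    using that stL HC[of "t - 2 * x w" "p x"] pC[of x] nonneg[of x w] points_C_subset by (auto simp: G_def)
  have p_id: "p x = x" if "x w = 0" for x using that by (auto simp: p_def)
  have st_0: "st 0 x = x" for x by (simp add: st_def fun_eq_iff field_simps)
  have "continuous_on ?S (\<lambda>z. if 2 * snd z w \<le> fst z then H (fst z - 2 * snd z w, p (snd z)) else st (fst z) (snd z))"
  proof (rule continuous_on_cases_le[where a = 0 and h = "\<lambda>z. 2 * snd z w - fst z", simplified])
    have coord: "continuous_on T (\<lambda>z :: real \<times> ('a \<Rightarrow> real). snd z v)" for T v
      by (rule continuous_on_product_then_coordinatewise[OF continuous_on_snd[OF continuous_on_id]])
    let ?T = "{z \<in> ?S. 2 * snd z w \<le> fst z}"
    have "continuous_on ?T (\<lambda>z. p (snd z) v)" for v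
      using coord by (cases "v = w") (auto simp: p_def intro!: continuous_intros)
    then have pc: "continuous_on ?T (\<lambda>z. p (snd z))"
      by (rule continuous_on_coordinatewise_then_product)
    have "continuous_on ?T (\<lambda>z. (fst z - 2 * snd z w, p (snd z)))"
      by (rule continuous_on_Pair[OF _ pc]) (intro continuous_intros coord)
    then show "continuous_on ?T (\<lambda>z. H (fst z - 2 * snd z w, p (snd z)))"
    proof (rule continuous_on_compose2[OF Hc])
      have "(fst z - 2 * snd z w, p (snd z)) \<in> {0..1} \<times> points C" if "z \<in> ?T" for z
        using that nonneg[of "snd z" w] pC[of "snd z"] by auto
      then show "(\<lambda>z. (fst z - 2 * snd z w, p (snd z))) ` ?T \<subseteq> {0..1} \<times> points C"
        by blast
    qed
    let ?T' = "{z \<in> ?S. fst z \<le> 2 * snd z w}"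
    have "continuous_on ?T' (\<lambda>z. st (fst z) (snd z) v)" for v
      using coord by (cases "v = w") (auto simp: st_def intro!: continuous_intros)
    then show "continuous_on ?T' (\<lambda>z. st (fst z) (snd z))"
      by (rule continuous_on_coordinatewise_then_product)
    show "continuous_on ?S (\<lambda>z. 2 * snd z w - fst z)" by (intro continuous_intros coord)
    show "H (fst z - 2 * snd z w, p (snd z)) = st (fst z) (snd z)" if "z \<in> ?S" "2 * snd z w = fst z" for z
      using that by (auto simp: H01 p_def st_def fun_eq_iff divide_simps)
  qed
  then have "continuous_on ?S G" by (simp add: G_def case_prod_beta)
  then have Gc: "continuous_map (prod_topology (top_of_set {0..1}) (realization L)) (realization L) G"
    using GL by (auto simp: realization_eq)
  let ?P = "\<lambda>h. \<forall>x\<in>points L. \<forall>y\<in>points L. q x = q y \<longrightarrow> q (h x) = q (h y)"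
  have "homotopic_with ?P (realization L) (realization L) (\<lambda>x. G (0, x)) (\<lambda>x. G (1, x))"
    unfolding homotopic_with_def
  proof (intro exI[of _ G] conjI Gc allI ballI impI HOL.refl)
    fix t x y assume t: "t \<in> {0..1::real}" and x: "x \<in> points L" "y \<in> points L" and qxy: "q x = q y"
    \<comment> \<open>Distinct points with the same class lie in |C|. There \<open>G\<close> agrees
      with \<open>H\<close>, whose stages stay in |C| and do not change the value of
      \<open>r\<close>.\<close>
    show "q (G (t, x)) = q (G (t, y))"
    proof (cases "x = y")
      case False
      then have w: "x w = 0" "y w = 0" and r: "r x = r y" using qxy q_eq_iff[OF x] by auto
      have "G (t, x) = H (t, x)" "G (t, y) = H (t, y)" using t w by (auto simp: G_def p_id)
      moreover have "H (t, x) \<in> points C" "H (t, y) \<in> points C" "r (H (t, x)) = r (H (t, y))"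
        using HC Hr t x w r points_C by auto
      ultimately show ?thesis using q_eq_iff points_C by auto
    qed simp
  qed
  then have "homotopic_with ?P (realization L) (realization L) id (\<lambda>x. G (1, x))"
  proof (rule homotopic_with_eq)
    show "id x = G (0, x)" if "x \<in> topspace (realization L)" for x
      using that nonneg[of x w] by (cases "x w = 0") (auto simp: G_def H01 p_id st_0)
    show "?P h \<longleftrightarrow> ?P k" if "\<And>x. x \<in> topspace (realization L) \<Longrightarrow> h x = k x" for h k
      using that by auto
  qed simp
  moreover have "G (1, x) = r x" if "x \<in> points C" for x
    using that points_C by (simp add: G_def H01 p_id)
  ultimately show ?thesis by blast
qed

lemma attach_space_homotopy_equivalent: "realization L homotopy_equivalent_space A"
proof -
  obtain k where k: "homotopic_with
      (\<lambda>h. \<forall>x\<in>points L. \<forall>y\<in>points L. q x = q y \<longrightarrow> q (h x) = q (h y)) (realization L) (realization L) id k"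
    "\<And>x. x \<in> points C \<Longrightarrow> k x = r x"
    using cone_extension by blast
  show ?thesis
  proof (rule quotient_homotopy_equivalent[OF compact_space_realization[OF L] Hausdorff_A q_quotient_map])
    show "k x = k y" if "x \<in> topspace (realization L)" "y \<in> topspace (realization L)" "q x = q y" for x y
      using that k(2) q_eq_iff points_C by (metis topspace_realization)
  qed (use k(1) in simp)
qed

end

section \<open>A simplex with one facet collapsed\<close>

text \<open>The facet of \<open>\<sigma>\<close> opposite \<open>w\<close> is collapsed along the fibres of \<open>f\<close>. The polytope \<open>flat\<close> is a
  model of the quotient: near the facet, i.e. where the coordinate \<open>x w\<close> is small, only the
  coordinates of one chosen representative of each fibre may be large. Only coordinates of a fibre
  with mass at least \<open>x w\<close> have to be moved, which is what the factor \<open>min 1 (x w / mass)\<close> in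
  \<open>flatten\<close> does.\<close>

locale collapsed_facet =
  fixes \<sigma> :: "'a set" and w :: 'a and f :: "'a \<Rightarrow> 'a"
  assumes fin: "finite \<sigma>" and w: "w \<in> \<sigma>" and f_w: "\<And>v. v \<in> \<sigma> \<Longrightarrow> f v = w \<longleftrightarrow> v = w"
begin

definition rep :: "'a \<Rightarrow> 'a" where
  "rep = inv_into (\<sigma> - {w}) f"

definition free :: "'a set" where
  "free = \<sigma> - {w} - rep ` f ` (\<sigma> - {w})"

definition free_mass :: "('a \<Rightarrow> real) \<Rightarrow> 'a \<Rightarrow> real" where
  "free_mass x u = (\<Sum>v | v \<in> free \<and> f v = u. x v)"

text \<open>The free coordinates over \<open>u\<close> are scaled by \<open>a u\<close>, and the
  representative of the fibre absorbs the difference. Hence fibre masses and the coordinate at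
  \<open>w\<close> are unchanged, and scaling by reciprocals undoes a shift wherever the factor is
  nonzero.\<close>

definition shift :: "('a \<Rightarrow> real) \<Rightarrow> ('a \<Rightarrow> real) \<Rightarrow> 'a \<Rightarrow> real" where
  "shift a x v = (if v \<in> free then x v * a (f v)
     else if v \<in> \<sigma> - {w} then realization_map f x (f v) - free_mass x (f v) * a (f v) else x v)"

text \<open>For a fibre of mass 0 the quotient, and so the factor, is 0 by convention. This does no
  harm, as all coordinates in such a fibre vanish for points of the simplex.\<close>

definition factor :: "('a \<Rightarrow> real) \<Rightarrow> 'a \<Rightarrow> real" where
  "factor x u = min 1 (x w / realization_map f x u)"

definition flatten :: "('a \<Rightarrow> real) \<Rightarrow> 'a \<Rightarrow> real" where
  "flatten x = shift (factor x) x"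

text \<open>The bound comes from the identity that \<open>factor\<close> times mass is the minimum
  of the mass and \<open>x w\<close>: free mass scaled by the factor cannot exceed this. On the
  facet \<open>x w = 0\<close> it forces all free coordinates to vanish, so that each fibre is
  concentrated in its representative.\<close>

definition flat :: "('a \<Rightarrow> real) set" where
  "flat = {x \<in> points (full_simplex \<sigma>). \<forall>u\<in>f ` (\<sigma> - {w}). free_mass x u \<le> x w}"

definition flat_interior :: "('a \<Rightarrow> real) set" where
  "flat_interior = {x \<in> open_simplex \<sigma>. \<forall>u\<in>f ` (\<sigma> - {w}). free_mass x u < x w}"

lemma rep: "u \<in> f ` (\<sigma> - {w}) \<Longrightarrow> rep u \<in> \<sigma> - {w} \<and> f (rep u) = u"
  unfolding rep_def using inv_into_into f_inv_into_f by metis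

lemma free_subset: "free \<subseteq> \<sigma> - {w}"
  by (auto simp: free_def)

lemma finite_free: "finite {v. v \<in> free \<and> f v = u}"
  using fin by (rule finite_subset[rotated]) (use free_subset in auto)

lemma rep_not_free: "u \<in> f ` (\<sigma> - {w}) \<Longrightarrow> rep u \<notin> free"
  by (auto simp: free_def)

lemma not_free: "v \<in> \<sigma> - {w} \<Longrightarrow> v \<notin> free \<Longrightarrow> rep (f v) = v"
proof -
  assume "v \<in> \<sigma> - {w}" "v \<notin> free"
  then obtain u where u: "u \<in> f ` (\<sigma> - {w})" "v = rep u" by (auto simp: free_def)
  then show ?thesis using rep[OF u(1)] by simp
qed

lemma fibre:
  assumes u: "u \<in> f ` (\<sigma> - {w})"
  shows "{v. v \<in> \<sigma> \<and> f v = u} = insert (rep u) {v. v \<in> free \<and> f v = u}"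
proof (intro equalityI subsetI)
  fix v assume v: "v \<in> {v. v \<in> \<sigma> \<and> f v = u}"
  obtain v' where "v' \<in> \<sigma> - {w}" "u = f v'" using u by blast
  then have "v \<noteq> w" using v f_w[of v] f_w[of v'] by auto
  then show "v \<in> insert (rep u) {v. v \<in> free \<and> f v = u}" using v not_free[of v] by auto
qed (use rep[OF u] free_subset in auto)

lemma mass_eq:
  assumes "supp x \<subseteq> \<sigma>" "u \<in> f ` (\<sigma> - {w})"
  shows "realization_map f x u = x (rep u) + free_mass x u"
  unfolding realization_map_eq[OF fin assms(1)] fibre[OF assms(2)] free_mass_def
  using finite_free rep_not_free[OF assms(2)] by simp

lemma mass_w:
  assumes "supp x \<subseteq> \<sigma>" shows "realization_map f x w = x w"
proof -
  have "{v. v \<in> \<sigma> \<and> f v = w} = {w}" using w f_w by auto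
  then show ?thesis by (simp add: realization_map_eq[OF fin assms])
qed

lemma mass_outside:
  assumes "supp x \<subseteq> \<sigma>" "u \<notin> f ` \<sigma>" shows "realization_map f x u = 0"
proof -
  have "{v. v \<in> \<sigma> \<and> f v = u} = {}" using assms by auto
  then show ?thesis by (simp only: realization_map_eq[OF fin assms(1)] sum.empty)
qed

lemma supp_shift: "supp x \<subseteq> \<sigma> \<Longrightarrow> supp (shift a x) \<subseteq> \<sigma>"
  using free_subset by (auto simp: supp_def shift_def split: if_splits)

lemma shift_w: "shift a x w = x w"
  using free_subset by (auto simp: shift_def)

lemma shift_free: "v \<in> free \<Longrightarrow> shift a x v = x v * a (f v)"
  by (simp add: shift_def)

lemma shift_rep:
  "u \<in> f ` (\<sigma> - {w}) \<Longrightarrow> shift a x (rep u) = realization_map f x u - free_mass x u * a u"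
  using rep[of u] rep_not_free[of u] by (simp add: shift_def)

lemma free_mass_shift: "free_mass (shift a x) u = free_mass x u * a u"
  unfolding free_mass_def sum_distrib_right by (intro sum.cong) (auto simp: shift_free)

lemma mass_shift:
  assumes "supp x \<subseteq> \<sigma>"
  shows "realization_map f (shift a x) = realization_map f x"
proof
  fix u
  consider "u \<in> f ` (\<sigma> - {w})" | "u = w" | "u \<notin> f ` \<sigma>" using f_w by blast
  then show "realization_map f (shift a x) u = realization_map f x u"
  proof cases
    case 1
    then show ?thesis
      by (simp add: mass_eq[OF supp_shift[OF assms] 1] shift_rep free_mass_shift)
  qed (simp_all add: mass_w mass_outside supp_shift assms shift_w)
qed

text \<open>The coordinate of a representative is the mass of its fibre minus the free mass, and the
  coordinate at \<open>w\<close> is the mass of the fibre of \<open>w\<close>.\<close>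

lemma fun_eq_by_mass:
  assumes "supp x \<subseteq> \<sigma>" "supp y \<subseteq> \<sigma>" "realization_map f x = realization_map f y"
    and free: "\<And>v. v \<in> free \<Longrightarrow> x v = y v"
  shows "x = y"
proof
  fix v
  consider "v \<in> free" | "v \<in> \<sigma> - {w}" "v \<notin> free" | "v = w" | "v \<notin> \<sigma>" by blast
  then show "x v = y v"
  proof cases
    case 2
    then have u: "f v \<in> f ` (\<sigma> - {w})" "rep (f v) = v" using not_free by auto
    have "free_mass x (f v) = free_mass y (f v)"
      unfolding free_mass_def by (intro sum.cong) (auto simp: free)
    then show ?thesis using mass_eq[OF assms(1) u(1)] mass_eq[OF assms(2) u(1)] assms(3) u(2) by simp
  next
    case 3
    then show ?thesis using mass_w[OF assms(1)] mass_w[OF assms(2)] assms(3) by simp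
  next
    case 4
    then have "x v = 0" "y v = 0" using assms(1,2) by (auto simp: supp_def)
    then show ?thesis by simp
  qed (rule free)
qed

text \<open>The factor depends only on fibre masses and on the coordinate at \<open>w\<close>. So
  the factor applied to a point can be read off from its image under \<open>flatten\<close>, which
  makes the inversion explicit.\<close>

lemma factor_shift: "supp x \<subseteq> \<sigma> \<Longrightarrow> factor (shift a x) = factor x"
  by (simp add: factor_def[abs_def] mass_shift shift_w)

lemma sum_shift: "supp x \<subseteq> \<sigma> \<Longrightarrow> sum (shift a x) \<sigma> = sum x \<sigma>"
  using sum_realization_map[OF fin, of x f] sum_realization_map[OF fin, of "shift a x" f]
  by (simp add: supp_shift mass_shift)

context
  fixes x
  assumes x: "x \<in> points (full_simplex \<sigma>)"
begin

lemma x_supp: "supp x \<subseteq> \<sigma>" and x_nonneg: "0 \<le> x v" and x_sum: "sum x \<sigma> = 1"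
proof -
  show "supp x \<subseteq> \<sigma>" "0 \<le> x v" using x by (auto simp: points_full_simplex barycentric_def)
  then show "sum x \<sigma> = 1" using x fin barycentric_sum points_full_simplex by blast
qed

lemma mass_nonneg: "0 \<le> realization_map f x u"
  by (rule realization_map_nonneg) (rule x_nonneg)

lemma free_mass_nonneg: "0 \<le> free_mass x u"
  unfolding free_mass_def using x_nonneg by (intro sum_nonneg)

lemma factor_bounds: "0 \<le> factor x u" "factor x u \<le> 1" "factor x u * realization_map f x u \<le> x w"
  using mass_nonneg[of u] x_nonneg[of w] by (auto simp: factor_def min_def divide_simps split: if_splits)

lemma le_mass: assumes "v \<in> \<sigma>" shows "x v \<le> realization_map f x (f v)"
  unfolding realization_map_eq[OF fin x_supp]
  using assms fin x_nonneg by (intro member_le_sum) auto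

lemma free_mass_le: "u \<in> f ` (\<sigma> - {w}) \<Longrightarrow> free_mass x u \<le> realization_map f x u"
  using mass_eq[OF x_supp, of u] x_nonneg[of "rep u"] by simp

lemma factor_0: "factor x u = 0 \<Longrightarrow> x w = 0 \<or> realization_map f x u = 0"
  by (auto simp: factor_def min_def split: if_splits)

lemma factor_mult_mass: "factor x u * realization_map f x u = min (realization_map f x u) (x w)"
  using mass_nonneg[of u] x_nonneg[of w] by (auto simp: factor_def min_def divide_simps split: if_splits)

lemma flatten_in_flat: "flatten x \<in> flat"
proof -
  let ?y = "flatten x"
  have "0 \<le> ?y v" for v
  proof (cases "v \<in> \<sigma> - {w} \<and> v \<notin> free")
    case True
    then have u: "f v \<in> f ` (\<sigma> - {w})" "rep (f v) = v" using not_free by auto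
    have "free_mass x (f v) * factor x (f v) \<le> free_mass x (f v) * 1"
      using free_mass_nonneg factor_bounds by (intro mult_left_mono)
    then show ?thesis using shift_rep[OF u(1)] u(2) free_mass_le[OF u(1)] by (simp add: flatten_def)
  qed (use x_nonneg factor_bounds in \<open>auto simp: flatten_def shift_def\<close>)
  then have "barycentric ?y"
    using fin supp_shift[OF x_supp] sum_shift[OF x_supp] x_sum
    by (intro barycentricI[of \<sigma>]) (auto simp: flatten_def)
  moreover have "free_mass ?y u \<le> ?y w" if u: "u \<in> f ` (\<sigma> - {w})" for u
  proof -
    have "free_mass x u * factor x u \<le> realization_map f x u * factor x u"
      using free_mass_le[OF u] factor_bounds by (intro mult_right_mono)
    then show ?thesis using factor_bounds(3)[of u] by (simp add: flatten_def free_mass_shift shift_w mult.commute)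
  qed
  ultimately show ?thesis
    using supp_shift[OF x_supp] by (auto simp: flat_def points_full_simplex flatten_def)
qed

lemma flatten_in_interior: "flatten x \<in> flat_interior \<longleftrightarrow> x \<in> open_simplex \<sigma>"
proof -
  let ?y = "flatten x"
  have y: "?y \<in> points (full_simplex \<sigma>)" using flatten_in_flat by (simp add: flat_def)
  have pos: "z \<in> open_simplex \<sigma> \<longleftrightarrow> (\<forall>v\<in>\<sigma>. 0 < z v)" if "z \<in> points (full_simplex \<sigma>)" for z
    using that by (auto simp: mem_open_simplex points_full_simplex supp_def barycentric_def less_le)
  \<comment> \<open>The two strict conditions say that the scaled free mass is below the mass and
    below \<open>x w\<close>, that is, below their minimum, which is \<open>factor\<close> times
    mass.\<close>
  have reps: "0 < ?y (rep u) \<and> free_mass ?y u < ?y w \<longleftrightarrow> free_mass x u * factor x u < factor x u * realization_map f x u"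
    if u: "u \<in> f ` (\<sigma> - {w})" for u
    unfolding factor_mult_mass by (simp add: flatten_def shift_rep[OF u] free_mass_shift shift_w)
  have mass_pos: "0 < realization_map f x (f v)" if "v \<in> \<sigma>" "0 < x v" for v
    using le_mass[OF that(1)] that(2) by linarith
  have factor_pos: "0 < factor x u" if "0 < x w" "0 < realization_map f x u" for u
    using that by (simp add: factor_def)
  show ?thesis
  proof
    assume "x \<in> open_simplex \<sigma>"
    then have p: "0 < x v" if "v \<in> \<sigma>" for v using pos[OF x] that by blast
    have r: "0 < ?y (rep u) \<and> free_mass ?y u < ?y w" if u: "u \<in> f ` (\<sigma> - {w})" for u
    proof -
      have "free_mass x u < realization_map f x u" using mass_eq[OF x_supp u] p rep[OF u] by simp
      moreover have "0 < factor x u" using factor_pos p w mass_pos u by auto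
      ultimately show ?thesis using reps[OF u] by simp
    qed
    have "0 < ?y v" if v: "v \<in> \<sigma>" for v
    proof -
      consider "v = w" | "v \<in> free" | "v \<in> \<sigma> - {w}" "v \<notin> free" using v by blast
      then show ?thesis
      proof cases
        case 2
        then show ?thesis using p[OF v] p[OF w] mass_pos[OF v] factor_pos by (simp add: flatten_def shift_free)
      next
        case 3
        then show ?thesis using r[of "f v"] not_free[of v] by simp
      qed (simp add: flatten_def shift_w p w)
    qed
    then show "?y \<in> flat_interior" using pos[OF y] r by (simp add: flat_interior_def)
  next
    assume "?y \<in> flat_interior"
    then have p: "\<And>v. v \<in> \<sigma> \<Longrightarrow> 0 < ?y v" and less: "\<And>u. u \<in> f ` (\<sigma> - {w}) \<Longrightarrow> free_mass ?y u < ?y w"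
      using pos[OF y] by (auto simp: flat_interior_def)
    have "0 < x v" if v: "v \<in> \<sigma>" for v
    proof -
      consider "v = w" | "v \<in> free" | "v \<in> \<sigma> - {w}" "v \<notin> free" using v by blast
      then show ?thesis
      proof cases
        case 1
        then show ?thesis using p[OF w] by (simp add: flatten_def shift_w)
      next
        case 2
        then show ?thesis using p[OF v] x_nonneg[of v] by (auto simp: flatten_def shift_free less_le)
      next
        case 3
        then have u: "f v \<in> f ` (\<sigma> - {w})" "rep (f v) = v" using not_free by auto
        have "free_mass x (f v) * factor x (f v) < factor x (f v) * realization_map f x (f v)"
          using reps[OF u(1)] p[OF v] less[OF u(1)] u(2) by simp
        then have "free_mass x (f v) < realization_map f x (f v)"
          using factor_bounds(1) by (metis mult.commute mult_left_mono not_less)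
        then show ?thesis using mass_eq[OF x_supp u(1)] u(2) by simp
      qed
    qed
    then show "x \<in> open_simplex \<sigma>" using pos[OF x] by blast
  qed
qed

end

text \<open>Off the facet the factor is recovered from the image and divided out; it is 0 only for a
  fibre of mass 0, where nothing is lost. On the facet every factor is 0, so precisely the fibre
  masses survive.\<close>

lemma flatten_eq_iff:
  assumes x: "x \<in> points (full_simplex \<sigma>)" and y: "y \<in> points (full_simplex \<sigma>)"
  shows "flatten x = flatten y \<longleftrightarrow>
    x = y \<or> (x w = 0 \<and> y w = 0 \<and> realization_map f x = realization_map f y)"
proof
  assume eq: "flatten x = flatten y"
  have m: "realization_map f x = realization_map f y"
    using arg_cong[OF eq, of "realization_map f"] by (simp add: flatten_def mass_shift x_supp x y)
  have w': "x w = y w" using fun_cong[OF eq, of w] by (simp add: flatten_def shift_w)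
  have fac: "factor x = factor y" by (simp add: factor_def[abs_def] m w')
  show "x = y \<or> (x w = 0 \<and> y w = 0 \<and> realization_map f x = realization_map f y)"
  proof (cases "x w = 0")
    case False
    have "x v = y v" if v: "v \<in> free" for v
    proof (cases "factor x (f v) = 0")
      case True
      have "v \<in> \<sigma>" using v free_subset by blast
      moreover have "realization_map f x (f v) = 0" using factor_0[OF x True] False by blast
      ultimately have "x v \<le> 0" "y v \<le> 0" using le_mass[OF x, of v] le_mass[OF y, of v] m by simp_all
      then show ?thesis using x_nonneg[OF x, of v] x_nonneg[OF y, of v] by linarith
    next
      case False
      then show ?thesis using fun_cong[OF eq, of v] v fac by (simp add: flatten_def shift_free)
    qed
    then show ?thesis using fun_eq_by_mass[OF x_supp[OF x] x_supp[OF y] m] by blast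
  qed (use w' m in simp)
next
  assume "x = y \<or> (x w = 0 \<and> y w = 0 \<and> realization_map f x = realization_map f y)"
  then consider "x = y" | "x w = 0" "y w = 0" "realization_map f x = realization_map f y" by blast
  then show "flatten x = flatten y"
  proof cases
    case 2
    have "factor x u = 0" "factor y u = 0" for u using 2 by (simp_all add: factor_def)
    then show ?thesis
      by - (rule fun_eq_by_mass, simp_all add: flatten_def supp_shift mass_shift x_supp x y 2 shift_free)
  qed simp
qed

lemma flatten_surj:
  assumes y: "y \<in> flat"
  shows "\<exists>x\<in>points (full_simplex \<sigma>). flatten x = y"
proof -
  have yp: "y \<in> points (full_simplex \<sigma>)" and yw: "\<And>u. u \<in> f ` (\<sigma> - {w}) \<Longrightarrow> free_mass y u \<le> y w"
    using y by (auto simp: flat_def)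
  note ys = x_supp[OF yp] and y0 = x_nonneg[OF yp]
  \<comment> \<open>\<open>factor y\<close> is also the factor of the preimage, so its reciprocal
    undoes the scaling. Where it is 0 the reciprocal is 0 too, and the free coordinates of
    \<open>y\<close> vanish there, as \<open>cancel\<close> shows.\<close>
  let ?a = "\<lambda>u. 1 / factor y u"
  let ?x = "shift ?a y"
  have le: "free_mass y u * ?a u \<le> realization_map f y u" if u: "u \<in> f ` (\<sigma> - {w})" for u
  proof (cases "factor y u = 0")
    case False
    then have "0 < factor y u" using factor_bounds(1)[OF yp, of u] by linarith
    moreover have "free_mass y u \<le> factor y u * realization_map f y u"
      unfolding factor_mult_mass[OF yp] using yw[OF u] free_mass_le[OF yp u] by simp
    ultimately show ?thesis by (simp add: field_simps)
  qed (simp add: mass_nonneg[OF yp])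
  have "0 \<le> ?x v" for v
  proof (cases "v \<in> \<sigma> - {w} \<and> v \<notin> free")
    case True
    then have u: "f v \<in> f ` (\<sigma> - {w})" "rep (f v) = v" using not_free by auto
    then show ?thesis using shift_rep[OF u(1), of ?a y] le[OF u(1)] by simp
  qed (use y0 factor_bounds[OF yp] in \<open>auto simp: shift_def\<close>)
  then have "barycentric ?x"
    using fin supp_shift[OF ys] sum_shift[OF ys] x_sum[OF yp] by (intro barycentricI[of \<sigma>]) auto
  then have x: "?x \<in> points (full_simplex \<sigma>)"
    using supp_shift[OF ys] by (simp add: points_full_simplex)
  have cancel: "y v = 0" if v: "v \<in> free" and fac: "factor y (f v) = 0" for v
  proof -
    have v': "v \<in> \<sigma> - {w}" using v free_subset by blast
    have "y v \<le> 0"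
    proof (cases "y w = 0")
      case True
      have "y v \<le> free_mass y (f v)"
        unfolding free_mass_def using finite_free v y0 by (intro member_le_sum) auto
      then show ?thesis using yw[of "f v"] True v' by fastforce
    next
      case False
      then show ?thesis using factor_0[OF yp fac] le_mass[OF yp, of v] v' by auto
    qed
    then show ?thesis using y0[of v] by simp
  qed
  have "flatten ?x = y"
    by (rule fun_eq_by_mass)
      (simp_all add: flatten_def supp_shift mass_shift factor_shift shift_free cancel ys)
  then show ?thesis using x by blast
qed

lemma continuous_on_flatten: "continuous_on (points (full_simplex \<sigma>)) flatten"
proof (rule continuous_on_coordinatewise_then_product)
  let ?S = "points (full_simplex \<sigma>)"
  have mass: "continuous_on ?S (\<lambda>x. realization_map f x u)" for u
    using continuous_on_product_then_coordinatewise[OF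
        continuous_on_realization_map_points[OF fin_complex_full_simplex[OF fin]]] .
  have free: "continuous_on ?S (\<lambda>x. x v * factor x (f v))" if v: "v \<in> free" for v
    unfolding continuous_on_def
  proof
    fix x assume x: "x \<in> ?S"
    have lim: "((\<lambda>x. x v) \<longlongrightarrow> x v) (at x within ?S)" "((\<lambda>x. x w) \<longlongrightarrow> x w) (at x within ?S)"
      "((\<lambda>x. realization_map f x (f v)) \<longlongrightarrow> realization_map f x (f v)) (at x within ?S)"
      using x continuous_on_coordinate[of ?S] mass[of "f v"] by (auto simp: continuous_on_def)
    show "((\<lambda>x. x v * factor x (f v)) \<longlongrightarrow> x v * factor x (f v)) (at x within ?S)"
    proof (cases "realization_map f x (f v) = 0")
      case False
      then show ?thesis unfolding factor_def using lim by (intro tendsto_intros tendsto_min)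
    next
      case True
      \<comment> \<open>The factor may jump where the mass of the fibre is 0. It is bounded by 1 and
        multiplied by a coordinate that tends to 0.\<close>
      have "v \<in> \<sigma>" using v free_subset by blast
      then have xv: "x v = 0" using le_mass[OF x, of v] x_nonneg[OF x, of v] True by simp
      have "norm (y v * factor y (f v)) \<le> y v" if "y \<in> ?S" for y
        using factor_bounds[OF that, of "f v"] x_nonneg[OF that, of v]
        by (simp add: abs_mult mult_left_le)
      then have "\<forall>\<^sub>F y in at x within ?S. norm (y v * factor y (f v)) \<le> y v"
        by (auto simp: eventually_at_filter)
      moreover have "((\<lambda>y. y v) \<longlongrightarrow> 0) (at x within ?S)" using lim(1) xv by simp
      ultimately have "((\<lambda>y. y v * factor y (f v)) \<longlongrightarrow> 0) (at x within ?S)"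
        by (rule Lim_null_comparison)
      then show ?thesis using xv by simp
    qed
  qed
  fix v
  consider "v \<in> free" | "v \<in> \<sigma> - {w}" "v \<notin> free" | "v \<notin> \<sigma> - {w}" by blast
  then show "continuous_on ?S (\<lambda>x. flatten x v)"
  proof cases
    case 1
    then show ?thesis using free by (simp add: flatten_def shift_free)
  next
    case 2
    have "continuous_on ?S (\<lambda>x. \<Sum>v' | v' \<in> free \<and> f v' = f v. x v' * factor x (f v'))"
      by (rule continuous_on_sum) (use free in blast)
    then have "continuous_on ?S (\<lambda>x. free_mass x (f v) * factor x (f v))"
      by (rule continuous_on_eq) (auto simp: free_mass_def sum_distrib_right intro!: sum.cong)
    then show ?thesis using 2 mass by (simp add: flatten_def shift_def continuous_on_diff)
  next
    case 3
    then have "flatten x v = x v" for x using free_subset by (auto simp: flatten_def shift_def)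
    then show ?thesis by (simp add: continuous_on_coordinate)
  qed
qed

lemma flat_cdisc:
  obtains h where "continuous_map (cdisc (simplex_dim \<sigma>)) (top_of_set flat) h"
    "inj_on h (topspace (cdisc (simplex_dim \<sigma>)))"
    "h ` topspace (odisc (simplex_dim \<sigma>)) = flat_interior"
    "h ` topspace (bsphere (simplex_dim \<sigma>)) = flat - flat_interior"
proof -
  let ?c = "\<lambda>v u. if u = v then 1 else 0 :: real"
  \<comment> \<open>The coefficient vector of the inequality that the free mass over
    \<open>u\<close> is at most \<open>x w\<close>.\<close>
  let ?d = "\<lambda>u v. if v = w then 1 else if v \<in> free \<and> f v = u then - 1 else 0 :: real"
  let ?J = "?c ` \<sigma> \<union> ?d ` f ` (\<sigma> - {w})"
  have c: "(\<Sum>u\<in>\<sigma>. ?c v u * x u) = x v" if "v \<in> \<sigma>" for v x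
    using fin that by (simp add: if_distrib[of "\<lambda>a. a * _"] cong: if_cong)
  have d: "(\<Sum>v\<in>\<sigma>. ?d u v * x v) = x w - free_mass x u" for u x
  proof -
    have "(\<Sum>v\<in>\<sigma>. ?d u v * x v) = x w + (\<Sum>v\<in>\<sigma> - {w}. ?d u v * x v)"
      using sum.remove[OF fin w, of "\<lambda>v. ?d u v * x v"] by simp
    also have "(\<Sum>v\<in>\<sigma> - {w}. ?d u v * x v) = (\<Sum>v | v \<in> free \<and> f v = u. - x v)"
      using fin free_subset by (intro sum.mono_neutral_cong_right) auto
    finally show ?thesis by (simp add: free_mass_def sum_negf)
  qed
  have ball: "(\<forall>c\<in>?J. P (\<Sum>v\<in>\<sigma>. c v * x v)) \<longleftrightarrow>
      (\<forall>v\<in>\<sigma>. P (x v)) \<and> (\<forall>u\<in>f ` (\<sigma> - {w}). P (x w - free_mass x u))" for P :: "real \<Rightarrow> bool" and x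
    unfolding ball_Un ball_simps(9) d using c by simp
  have bary: "barycentric x \<and> supp x \<subseteq> \<sigma> \<longleftrightarrow> (\<forall>v. v \<notin> \<sigma> \<longrightarrow> x v = 0) \<and> sum x \<sigma> = 1 \<and> (\<forall>v\<in>\<sigma>. 0 \<le> x v)" for x
  proof
    assume R: "(\<forall>v. v \<notin> \<sigma> \<longrightarrow> x v = 0) \<and> sum x \<sigma> = 1 \<and> (\<forall>v\<in>\<sigma>. 0 \<le> x v)"
    then have "supp x \<subseteq> \<sigma>" "0 \<le> x v" for v by (auto simp: supp_def)
    then show "barycentric x \<and> supp x \<subseteq> \<sigma>" using R fin by (auto intro: barycentricI)
  qed (use fin barycentric_sum in \<open>auto simp: barycentric_def supp_def\<close>)
  have flat: "flat = {x. (\<forall>v. v \<notin> \<sigma> \<longrightarrow> x v = 0) \<and> sum x \<sigma> = 1 \<and> (\<forall>c\<in>?J. 0 \<le> (\<Sum>v\<in>\<sigma>. c v * x v))}"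
    unfolding ball flat_def points_full_simplex bary by auto
  have int: "flat_interior = {x. (\<forall>v. v \<notin> \<sigma> \<longrightarrow> x v = 0) \<and> sum x \<sigma> = 1 \<and> (\<forall>c\<in>?J. 0 < (\<Sum>v\<in>\<sigma>. c v * x v))}"
    unfolding ball flat_interior_def open_simplex_def by auto
  \<comment> \<open>The barycentre can violate the free mass bounds, so its image under
    \<open>flatten\<close> serves as the interior point.\<close>
  define b where "b v = (if v \<in> \<sigma> then 1 / card \<sigma> else 0)" for v
  have "0 < card \<sigma>" using fin w card_gt_0_iff by blast
  then have "b \<in> open_simplex \<sigma>" by (auto simp: open_simplex_def b_def)
  then have "flatten b \<in> flat_interior"
    using flatten_in_interior[of b] by (simp add: mem_open_simplex points_full_simplex)
  then have ne: "flat_interior \<noteq> {}" by blast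
  have finJ: "finite ?J" using fin by simp
  have coord: "?c v \<in> ?J" if "v \<in> \<sigma>" for v using that by blast
  show thesis
    using polytope_cdisc[OF fin finJ coord flat int ne] that unfolding simplex_dim_def by metis
qed

end

section \<open>The cells\<close>

text \<open>An injective continuous map from the compact disc into a Hausdorff space is an
  embedding, so it restricts to homeomorphisms on the open disc and on the sphere. With finitely
  many cells the weak topology condition is a finite union of closed sets.\<close>

lemma finite_regular_cw_complexI:
  assumes X: "Hausdorff_space X" and I: "finite I" and disj: "disjoint_family_on e I"
    and un: "(\<Union>i\<in>I. e i) = topspace X"
    and cell: "\<And>i. i \<in> I \<Longrightarrow> \<exists>\<Phi>. continuous_map (cdisc (d i)) X \<Phi> \<and> inj_on \<Phi> (topspace (cdisc (d i))) \<and>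
      \<Phi> ` topspace (odisc (d i)) = e i \<and>
      \<Phi> ` topspace (bsphere (d i)) \<subseteq> (\<Union>j\<in>{j \<in> I. d j < d i}. e j)"
  shows "regular_cw_complex X I e d"
proof -
  let ?P = "\<lambda>i \<Phi>. continuous_map (cdisc (d i)) X \<Phi> \<and> inj_on \<Phi> (topspace (cdisc (d i))) \<and>
      \<Phi> ` topspace (odisc (d i)) = e i \<and>
      \<Phi> ` topspace (bsphere (d i)) \<subseteq> (\<Union>j\<in>{j \<in> I. d j < d i}. e j)"
  have "\<forall>i\<in>I. \<exists>\<Phi>. ?P i \<Phi>" by (rule ballI) (rule cell)
  from bchoice[OF this] obtain \<Phi> where \<Phi>: "\<forall>i\<in>I. ?P i (\<Phi> i)" ..
  have cont: "continuous_map (cdisc (d i)) X (\<Phi> i)"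
    and inj: "inj_on (\<Phi> i) (topspace (cdisc (d i)))"
    and open_cell: "\<Phi> i ` topspace (odisc (d i)) = e i"
    and bd: "\<Phi> i ` topspace (bsphere (d i)) \<subseteq> (\<Union>j\<in>{j \<in> I. d j < d i}. e j)" if "i \<in> I" for i
    using bspec[OF \<Phi> that] by blast+
  have homeo: "homeomorphic_map (subtopology (cdisc (d i)) S)
      (subtopology X (\<Phi> i ` topspace (subtopology (cdisc (d i)) S))) (\<Phi> i)" if i: "i \<in> I" for i S
  proof -
    have "embedding_map (cdisc (d i)) X (\<Phi> i)"
      by (rule continuous_imp_embedding_map[OF cont[OF i] compact_space_cdisc X inj[OF i]])
    then have "homeomorphic_map (cdisc (d i)) (subtopology X (\<Phi> i ` topspace (cdisc (d i)))) (\<Phi> i)"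
      by (simp add: embedding_map_def)
    then have "homeomorphic_map (subtopology (cdisc (d i)) S)
        (subtopology (subtopology X (\<Phi> i ` topspace (cdisc (d i)))) (\<Phi> i ` (topspace (cdisc (d i)) \<inter> S))) (\<Phi> i)"
    proof (rule homeomorphic_map_subtopologies)
      have "\<Phi> i ` topspace (cdisc (d i)) \<subseteq> topspace X"
        using cont[OF i] continuous_map_image_subset_topspace by blast
      then show "\<Phi> i ` (topspace (cdisc (d i)) \<inter> S) =
          topspace (subtopology X (\<Phi> i ` topspace (cdisc (d i)))) \<inter> \<Phi> i ` (topspace (cdisc (d i)) \<inter> S)"
        by auto
    qed
    moreover have "\<Phi> i ` topspace (cdisc (d i)) \<inter> \<Phi> i ` (topspace (cdisc (d i)) \<inter> S) =
        \<Phi> i ` topspace (subtopology (cdisc (d i)) S)" by auto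
    ultimately show ?thesis by (simp add: subtopology_subtopology)
  qed
  have weak: "closedin X S \<longleftrightarrow> (\<forall>i\<in>I. closedin X (S \<inter> X closure_of e i))" if S: "S \<subseteq> topspace X" for S
  proof
    assume all: "\<forall>i\<in>I. closedin X (S \<inter> X closure_of e i)"
    have "x \<in> (\<Union>i\<in>I. S \<inter> X closure_of e i)" if x: "x \<in> S" for x
    proof -
      obtain i where i: "i \<in> I" "x \<in> e i" using x S un by blast
      have "e i \<subseteq> X closure_of e i"
        by (rule closure_of_subset) (use un i in blast)
      then show ?thesis using i x by blast
    qed
    then have "S = (\<Union>i\<in>I. S \<inter> X closure_of e i)" by blast
    moreover have "closedin X (\<Union>i\<in>I. S \<inter> X closure_of e i)"
      by (rule closedin_Union) (use I all in auto)
    ultimately show "closedin X S" by simp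
  qed (auto intro: closedin_Int)
  have "\<exists>J\<subseteq>I. finite J \<and> (\<forall>j\<in>J. d j < d i) \<and> \<Phi> i ` topspace (bsphere (d i)) \<subseteq> (\<Union>j\<in>J. e j)"
    if "i \<in> I" for i
    using bd[OF that] I by (intro exI[of _ "{j \<in> I. d j < d i}"]) auto
  moreover have "homeomorphic_map (odisc (d i)) (subtopology X (e i)) (\<Phi> i)" if "i \<in> I" for i
    using homeo[OF that, of "{x. (\<Sum>i<d i. (x i)\<^sup>2) < 1}", folded odisc_eq] open_cell[OF that] by simp
  ultimately have "cw_complex X I e d \<Phi>"
    unfolding cw_complex_def using X disj un cont weak by blast
  moreover have "homeomorphic_map (bsphere (d i))
      (subtopology X (\<Phi> i ` topspace (bsphere (d i)))) (\<Phi> i)" if "i \<in> I" for i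
    using homeo[OF that, of "{x. (\<Sum>i<d i. (x i)\<^sup>2) = 1}", folded bsphere_eq] .
  ultimately show ?thesis unfolding regular_cw_complex_def by blast
qed

text \<open>The case f = id of the collapsed facet: fibres are singletons, no vertex is free, and
  the polytope is the simplex itself.\<close>

lemma simplex_cdisc:
  assumes \<sigma>: "finite \<sigma>" "\<sigma> \<noteq> {}"
  obtains h where "continuous_map (cdisc (simplex_dim \<sigma>)) (realization (full_simplex \<sigma>)) h"
    "inj_on h (topspace (cdisc (simplex_dim \<sigma>)))"
    "h ` topspace (odisc (simplex_dim \<sigma>)) = open_simplex \<sigma>"
    "h ` topspace (bsphere (simplex_dim \<sigma>)) = points (full_simplex \<sigma>) - open_simplex \<sigma>"
proof -
  obtain w where w: "w \<in> \<sigma>" using \<sigma> by blast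
  interpret collapsed_facet \<sigma> w id using \<sigma> w by unfold_locales auto
  have "free = {}" using rep by (auto simp: free_def image_iff)
  then have mass: "free_mass x u = 0" for x u by (simp add: free_mass_def)
  have "flat = points (full_simplex \<sigma>)"
    by (auto simp: flat_def mass points_full_simplex barycentric_def)
  moreover have "flat_interior = open_simplex \<sigma>"
    using w by (auto simp: flat_interior_def mass open_simplex_def)
  ultimately show thesis using flat_cdisc that unfolding realization_eq by metis
qed

section \<open>Closed cells of the pushout, their disjointness and their boundaries\<close>

context star_attachment
begin

lemma L_simplex_finite: "\<sigma> \<in> L \<Longrightarrow> finite \<sigma>" and L_simplex_nonempty: "\<sigma> \<in> L \<Longrightarrow> \<sigma> \<noteq> {}"
  using L by (auto simp: fin_complex_def)

lemma M_subset_L: "M \<subseteq> L"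
  by (rule subset_trans[OF M(1) delete_vertex_subset])

lemma q_continuous_full_simplex:
  assumes "\<sigma> \<in> L" shows "continuous_map (realization (full_simplex \<sigma>)) A q"
  unfolding realization_subtopology[OF full_simplex_subset[OF L assms]]
  by (rule continuous_map_from_subtopology[OF q_continuous])

lemma full_simplex_points: "\<sigma> \<in> L \<Longrightarrow> x \<in> points (full_simplex \<sigma>) \<Longrightarrow> x \<in> points L"
  by (rule subsetD[OF points_mono[OF full_simplex_subset[OF L]]])

text \<open>\<open>r\<close> is the identity on |M|, so \<open>q\<close> is injective there and the
  disc of the simplex itself can be used.\<close>

lemma base_cell:
  assumes \<sigma>: "\<sigma> \<in> M"
  shows "\<exists>\<Phi>. continuous_map (cdisc (simplex_dim \<sigma>)) A \<Phi> \<and> inj_on \<Phi> (topspace (cdisc (simplex_dim \<sigma>))) \<and>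
    \<Phi> ` topspace (odisc (simplex_dim \<sigma>)) = q ` open_simplex \<sigma> \<and>
    \<Phi> ` topspace (bsphere (simplex_dim \<sigma>)) \<subseteq> q ` (points (full_simplex \<sigma>) - open_simplex \<sigma>)"
proof -
  have \<sigma>L: "\<sigma> \<in> L" using \<sigma> M_subset_L by blast
  obtain h where h: "continuous_map (cdisc (simplex_dim \<sigma>)) (realization (full_simplex \<sigma>)) h"
    "inj_on h (topspace (cdisc (simplex_dim \<sigma>)))"
    "h ` topspace (odisc (simplex_dim \<sigma>)) = open_simplex \<sigma>"
    "h ` topspace (bsphere (simplex_dim \<sigma>)) = points (full_simplex \<sigma>) - open_simplex \<sigma>"
    using simplex_cdisc[OF L_simplex_finite[OF \<sigma>L] L_simplex_nonempty[OF \<sigma>L]] by metis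
  have pM: "points (full_simplex \<sigma>) \<subseteq> points M"
    by (rule points_mono[OF full_simplex_subset[OF M(2) \<sigma>]])
  have "inj_on q (points (full_simplex \<sigma>))"
  proof (rule inj_onI)
    fix x y assume x: "x \<in> points (full_simplex \<sigma>)" and y: "y \<in> points (full_simplex \<sigma>)" and "q x = q y"
    then have "x = y \<or> r x = r y"
      using q_eq_iff[OF full_simplex_points[OF \<sigma>L x] full_simplex_points[OF \<sigma>L y]] by blast
    moreover have "r x = x" "r y = y" using r_fixes x y pM by blast+
    ultimately show "x = y" by metis
  qed
  moreover have "h ` topspace (cdisc (simplex_dim \<sigma>)) \<subseteq> points (full_simplex \<sigma>)"
    using continuous_map_image_subset_topspace[OF h(1)] by simp
  ultimately have "inj_on (q \<circ> h) (topspace (cdisc (simplex_dim \<sigma>)))"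
    using h(2) by (meson comp_inj_on inj_on_subset)
  then show ?thesis
    using continuous_map_compose[OF h(1) q_continuous_full_simplex[OF \<sigma>L]] h(3,4)
    by (intro exI[of _ "q \<circ> h"]) (simp only: image_comp[symmetric] simp_thms subset_refl)
qed

text \<open>On the closed simplex \<open>flatten\<close> and \<open>q\<close> have the same fibres,
  so \<open>q\<close> factors through the polytope by an injective map. Composing it with the disc
  structure of the polytope yields a characteristic map that is injective on the boundary
  too.\<close>

lemma attached_cell:
  assumes \<sigma>: "\<sigma> \<in> open_star w L"
  shows "\<exists>\<Phi>. continuous_map (cdisc (simplex_dim \<sigma>)) A \<Phi> \<and> inj_on \<Phi> (topspace (cdisc (simplex_dim \<sigma>))) \<and>
    \<Phi> ` topspace (odisc (simplex_dim \<sigma>)) = q ` open_simplex \<sigma> \<and>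
    \<Phi> ` topspace (bsphere (simplex_dim \<sigma>)) \<subseteq> q ` (points (full_simplex \<sigma>) - open_simplex \<sigma>)"
proof -
  have \<sigma>L: "\<sigma> \<in> L" and w: "w \<in> \<sigma>" using \<sigma> by (auto simp: open_star_def)
  note fin\<sigma> = L_simplex_finite[OF \<sigma>L]
  interpret collapsed_facet \<sigma> w f
    using fin\<sigma> w f_eq_w by unfold_locales auto
  let ?S = "points (full_simplex \<sigma>)"
  have flatten_eq_q: "flatten x = flatten y \<longleftrightarrow> q x = q y" if x: "x \<in> ?S" and y: "y \<in> ?S" for x y
  proof -
    have xL: "x \<in> points L" "y \<in> points L" using full_simplex_points[OF \<sigma>L] x y by blast+
    have "r z = realization_map f z" if "z \<in> points L" "z w = 0" for z
      using that points_C r_eq by blast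
    then show ?thesis unfolding flatten_eq_iff[OF x y] q_eq_iff[OF xL] using xL by metis
  qed
  have surj: "flatten ` ?S = flat" using flatten_in_flat flatten_surj by blast
  have quot: "quotient_map (realization (full_simplex \<sigma>)) (top_of_set flat) flatten"
  proof (rule T1_Spaces.continuous_imp_quotient_map)
    show "continuous_map (realization (full_simplex \<sigma>)) (top_of_set flat) flatten"
      using continuous_on_flatten surj by (auto simp: realization_eq)
  qed (simp_all add: compact_space_realization fin_complex_full_simplex fin\<sigma>
      Hausdorff_fun Hausdorff_space_subtopology surj)
  have "\<exists>\<psi>. continuous_map (top_of_set flat) A \<psi> \<and> (\<forall>x\<in>topspace (realization (full_simplex \<sigma>)). \<psi> (flatten x) = q x)"
    by (rule quotient_map_factor[OF quot q_continuous_full_simplex[OF \<sigma>L]]) (simp add: flatten_eq_q)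
  then obtain \<psi> where \<psi>: "continuous_map (top_of_set flat) A \<psi>" "\<And>x. x \<in> ?S \<Longrightarrow> \<psi> (flatten x) = q x"
    by auto
  have inj: "inj_on \<psi> flat"
    unfolding surj[symmetric] by (auto simp: inj_on_def \<psi>(2) flatten_eq_q)
  have sub: "open_simplex \<sigma> \<subseteq> ?S"
    by (auto simp: mem_open_simplex points_full_simplex)
  have int: "flatten ` open_simplex \<sigma> = flat_interior"
  proof (intro equalityI subsetI)
    fix y assume y: "y \<in> flat_interior"
    then have "y \<in> flat" using sub by (auto simp: flat_def flat_interior_def less_imp_le)
    then obtain x where "x \<in> ?S" "y = flatten x" using flatten_surj by blast
    then show "y \<in> flatten ` open_simplex \<sigma>" using flatten_in_interior y by blast
  qed (use sub flatten_in_interior in auto)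
  have "\<psi> ` flat_interior = q ` open_simplex \<sigma>"
    unfolding int[symmetric] image_image using sub \<psi>(2) by (intro image_cong) auto
  moreover have "\<psi> ` (flat - flat_interior) \<subseteq> q ` (?S - open_simplex \<sigma>)"
  proof
    fix z assume "z \<in> \<psi> ` (flat - flat_interior)"
    then obtain y where y: "y \<in> flat" "y \<notin> flat_interior" "z = \<psi> y" by blast
    then obtain x where "x \<in> ?S" "y = flatten x" using flatten_surj by blast
    then show "z \<in> q ` (?S - open_simplex \<sigma>)" using y \<psi>(2) int by blast
  qed
  moreover obtain h where h: "continuous_map (cdisc (simplex_dim \<sigma>)) (top_of_set flat) h"
    "inj_on h (topspace (cdisc (simplex_dim \<sigma>)))"
    "h ` topspace (odisc (simplex_dim \<sigma>)) = flat_interior"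
    "h ` topspace (bsphere (simplex_dim \<sigma>)) = flat - flat_interior"
    using flat_cdisc by metis
  moreover have "inj_on (\<psi> \<circ> h) (topspace (cdisc (simplex_dim \<sigma>)))"
  proof -
    have "h ` topspace (cdisc (simplex_dim \<sigma>)) \<subseteq> flat"
      using continuous_map_image_subset_topspace[OF h(1)] by simp
    then show ?thesis using h(2) inj by (meson comp_inj_on inj_on_subset)
  qed
  ultimately show ?thesis
    using continuous_map_compose[OF h(1) \<psi>(1)]
    by (intro exI[of _ "\<psi> \<circ> h"]) (simp only: image_comp[symmetric] simp_thms)
qed

abbreviation cells :: "('a set + 'a set) set" where "cells \<equiv> M <+> open_star w L"

abbreviation cell_dim :: "'a set + 'a set \<Rightarrow> nat" where "cell_dim \<equiv> case_sum simplex_dim simplex_dim"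

abbreviation cell :: "'a set + 'a set \<Rightarrow> (bool \<times> ('a \<Rightarrow> real)) set set" where
  "cell \<equiv> attach_cell L w M r"

lemma cell_Inl: "\<sigma> \<in> M \<Longrightarrow> cell (Inl \<sigma>) = q ` open_simplex \<sigma>"
  using open_simplex_subset_points[of \<sigma> M] by (auto simp: in2_eq_q intro!: image_cong)

lemma cell_Inr: "cell (Inr \<sigma>) = q ` open_simplex \<sigma>"
  by (simp add: q_def)

text \<open>A point of the deletion is represented by its image under \<open>r\<close>, whose
  support is the image of a simplex under \<open>f\<close> and so has no more vertices. This
  dimension bound is what puts boundaries into lower cells after the collapse.\<close>

lemma point_in_cell:
  assumes x: "x \<in> points L"
  shows "\<exists>j\<in>cells. q x \<in> cell j \<and> cell_dim j \<le> simplex_dim (supp x)"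
proof (cases "x w = 0")
  case True
  then have xC: "x \<in> points C" using x points_C by blast
  have rM: "r x \<in> points M" by (rule r_points[OF xC])
  then have rL: "r x \<in> points L" "r x w = 0" "r (r x) = r x"
    using points_M_subset points_C r_fixes by auto
  then have "q x = q (r x)" using q_eq_iff[OF x rL(1)] True by simp
  moreover have \<rho>: "supp (r x) \<in> M" "r x \<in> open_simplex (supp (r x))"
    using rM by (auto simp: points_def mem_open_simplex)
  ultimately have "q x \<in> cell (Inl (supp (r x)))" unfolding cell_Inl[OF \<rho>(1)] by blast
  moreover have "simplex_dim (supp (r x)) \<le> simplex_dim (supp x)"
  proof -
    have b: "barycentric x" using x by (auto simp: points_def)
    have "card (f ` supp x) \<le> card (supp x)" using supp_finite[OF b] by (rule card_image_le)
    then show ?thesis by (simp add: simplex_dim_def r_eq[OF xC] supp_realization_map[OF b])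
  qed
  ultimately show ?thesis using \<rho>(1) by (intro bexI[of _ "Inl (supp (r x))"]) auto
next
  case False
  then have "supp x \<in> open_star w L" using x by (auto simp: points_def open_star_def supp_def)
  moreover have "q x \<in> cell (Inr (supp x))"
    unfolding cell_Inr using x by (auto simp: mem_open_simplex points_def)
  ultimately show ?thesis by (intro bexI[of _ "Inr (supp x)"]) auto
qed

text \<open>Each class has exactly one representative that lies either in |M| or off the deletion:
  \<open>r\<close> fixes |M|, and off the deletion nothing is identified. The support of this
  representative names the cell.\<close>

lemma cells_disjoint: "disjoint_family_on cell cells"
proof -
  have pts: "\<exists>x. x \<in> points L \<and> z = q x \<and> (case i of Inl \<sigma> \<Rightarrow> x \<in> points M \<and> supp x = \<sigma> | Inr \<sigma> \<Rightarrow> x w \<noteq> 0 \<and> supp x = \<sigma>)"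
    if iz: "i \<in> cells" "z \<in> cell i" for i z
  proof (cases i)
    case (Inl \<sigma>)
    then have "\<sigma> \<in> M" using iz(1) by auto
    with Inl obtain x where "x \<in> open_simplex \<sigma>" "z = q x" using iz(2) cell_Inl by auto
    then show ?thesis using Inl \<open>\<sigma> \<in> M\<close> M_subset_L
      by (intro exI[of _ x]) (auto simp: points_def mem_open_simplex)
  next
    case (Inr \<sigma>)
    then have "\<sigma> \<in> open_star w L" using iz(1) by auto
    with Inr obtain x where "x \<in> open_simplex \<sigma>" "z = q x" using iz(2) cell_Inr by auto
    then show ?thesis using Inr \<open>\<sigma> \<in> open_star w L\<close>
      by (intro exI[of _ x]) (auto simp: points_def mem_open_simplex open_star_def supp_def)
  qed
  have "i = j" if i: "i \<in> cells" "z \<in> cell i" and j: "j \<in> cells" "z \<in> cell j" for i j z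
  proof -
    obtain x where x: "x \<in> points L" "z = q x"
        "case i of Inl \<sigma> \<Rightarrow> x \<in> points M \<and> supp x = \<sigma> | Inr \<sigma> \<Rightarrow> x w \<noteq> 0 \<and> supp x = \<sigma>"
      using pts[OF i] by blast
    obtain y where y: "y \<in> points L" "z = q y"
        "case j of Inl \<sigma> \<Rightarrow> y \<in> points M \<and> supp y = \<sigma> | Inr \<sigma> \<Rightarrow> y w \<noteq> 0 \<and> supp y = \<sigma>"
      using pts[OF j] by blast
    have M0: "u w = 0 \<and> r u = u" if "u \<in> points M" for u
      using that points_M_subset points_C r_fixes by blast
    have "x = y \<or> (x w = 0 \<and> y w = 0 \<and> r x = r y)" using q_eq_iff[OF x(1) y(1)] x(2) y(2) by simp
    then show ?thesis using x(3) y(3) M0[of x] M0[of y] by (auto split: sum.splits)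
  qed
  then show ?thesis unfolding disjoint_family_on_def by blast
qed

lemma cells_cover: "(\<Union>i\<in>cells. cell i) = topspace A"
proof (intro equalityI subsetI)
  fix z assume "z \<in> (\<Union>i\<in>cells. cell i)"
  then obtain i where i: "i \<in> cells" "z \<in> cell i" by blast
  obtain \<sigma> where \<sigma>: "\<sigma> \<in> L" "cell i = q ` open_simplex \<sigma>"
  proof (cases i)
    case (Inl \<sigma>)
    then show thesis using that[of \<sigma>] i(1) cell_Inl M_subset_L by auto
  next
    case (Inr \<sigma>)
    then show thesis using that[of \<sigma>] i(1) cell_Inr by (auto simp: open_star_def)
  qed
  then show "z \<in> topspace A"
    using i(2) open_simplex_subset_points[OF \<sigma>(1)] unfolding topspace_A by blast
next
  fix z assume "z \<in> topspace A"
  then show "z \<in> (\<Union>i\<in>cells. cell i)" using point_in_cell unfolding topspace_A by blast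
qed

lemma boundary_in_cells:
  assumes \<sigma>: "\<sigma> \<in> L"
  shows "q ` (points (full_simplex \<sigma>) - open_simplex \<sigma>) \<subseteq> (\<Union>j\<in>{j \<in> cells. cell_dim j < simplex_dim \<sigma>}. cell j)"
proof
  fix z assume "z \<in> q ` (points (full_simplex \<sigma>) - open_simplex \<sigma>)"
  then obtain x where x: "x \<in> points (full_simplex \<sigma>)" "x \<notin> open_simplex \<sigma>" "z = q x" by blast
  then have b: "barycentric x" and s: "supp x \<subset> \<sigma>"
    by (auto simp: points_full_simplex mem_open_simplex)
  \<comment> \<open>\<open>simplex_dim\<close> truncates at 0, so strict monotonicity needs a
    nonempty support.\<close>
  have "0 < card (supp x)" using supp_finite[OF b] supp_nonempty[OF b] by (simp add: card_gt_0_iff)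
  then have "simplex_dim (supp x) < simplex_dim \<sigma>"
    using psubset_card_mono[OF L_simplex_finite[OF \<sigma>] s] by (simp add: simplex_dim_def)
  then show "z \<in> (\<Union>j\<in>{j \<in> cells. cell_dim j < simplex_dim \<sigma>}. cell j)"
    using point_in_cell[OF full_simplex_points[OF \<sigma> x(1)]] x(3) by fastforce
qed

lemma attach_space_regular: "regular_cw_complex A cells cell cell_dim"
proof (rule finite_regular_cw_complexI[OF Hausdorff_A _ cells_disjoint cells_cover])
  have "finite M" "finite L" using M L by (auto simp: fin_complex_def)
  then show "finite cells" by (auto simp: open_star_def)
next
  fix i assume "i \<in> cells"
  show "\<exists>\<Phi>. continuous_map (cdisc (cell_dim i)) A \<Phi> \<and> inj_on \<Phi> (topspace (cdisc (cell_dim i))) \<and>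
      \<Phi> ` topspace (odisc (cell_dim i)) = cell i \<and>
      \<Phi> ` topspace (bsphere (cell_dim i)) \<subseteq> (\<Union>j\<in>{j \<in> cells. cell_dim j < cell_dim i}. cell j)"
  proof (cases i)
    case (Inl \<sigma>)
    then have \<sigma>: "\<sigma> \<in> M" "\<sigma> \<in> L" using \<open>i \<in> cells\<close> M_subset_L by auto
    show ?thesis
      using base_cell[OF \<sigma>(1)] boundary_in_cells[OF \<sigma>(2)]
      unfolding Inl cell_Inl[OF \<sigma>(1)] sum.case by (meson subset_trans)
  next
    case (Inr \<sigma>)
    then have \<sigma>: "\<sigma> \<in> open_star w L" "\<sigma> \<in> L" using \<open>i \<in> cells\<close> by (auto simp: open_star_def)
    show ?thesis
      using attached_cell[OF \<sigma>(1)] boundary_in_cells[OF \<sigma>(2)]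
      unfolding Inr cell_Inr sum.case by (meson subset_trans)
  qed
qed

end

theorem lemma3p6:
  fixes K :: "'a set set" and g :: "'a \<Rightarrow> real" and \<alpha> \<beta> :: real
  assumes "fin_complex K" and "\<alpha> < \<beta>"
  shows
    "({v \<in> vertices K. \<alpha> < g v \<and> g v \<le> \<beta> \<and> strong_critical g K v} = {} \<longrightarrow>
        strong_collapses_to (sublevel g K \<beta>) (sublevel g K \<alpha>))
     \<and>
     (\<forall>w. {v \<in> vertices K. \<alpha> < g v \<and> g v \<le> \<beta> \<and> strong_critical g K v} = {w} \<longrightarrow>
        (\<exists>r. strong_collapse (delete_vertex (sublevel g K (g w)) w) (sublevel g K \<alpha>) r \<and>
             realization (sublevel g K \<beta>) homotopy_equivalent_space
               attach_space (sublevel g K (g w)) w (sublevel g K \<alpha>) r \<and>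
             regular_cw_complex
               (attach_space (sublevel g K (g w)) w (sublevel g K \<alpha>) r)
               (sublevel g K \<alpha> <+> descending_star g K w)
               (attach_cell (sublevel g K (g w)) w (sublevel g K \<alpha>) r)
               (case_sum simplex_dim simplex_dim)))"
proof -
  note K = assms(1)
  let ?crit = "{v \<in> vertices K. \<alpha> < g v \<and> g v \<le> \<beta> \<and> strong_critical g K v}"
  have A: "strong_collapses_to (sublevel g K \<beta>) (sublevel g K \<alpha>)" if "?crit = {}"
    using that assms(2) by (intro sublevel_strong_collapse[OF K]) auto
  have B: "\<exists>r. strong_collapse (delete_vertex (sublevel g K (g w)) w) (sublevel g K \<alpha>) r \<and>
             realization (sublevel g K \<beta>) homotopy_equivalent_space
               attach_space (sublevel g K (g w)) w (sublevel g K \<alpha>) r \<and>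
             regular_cw_complex
               (attach_space (sublevel g K (g w)) w (sublevel g K \<alpha>) r)
               (sublevel g K \<alpha> <+> descending_star g K w)
               (attach_cell (sublevel g K (g w)) w (sublevel g K \<alpha>) r)
               (case_sum simplex_dim simplex_dim)" if crit: "?crit = {w}" for w
  proof -
    let ?L = "sublevel g K (g w)" and ?M = "sublevel g K \<alpha>"
    have w: "w \<in> vertices K" "\<alpha> < g w" "g w \<le> \<beta>" using crit by blast+
    have noncrit: "\<not> strong_critical g K v"
      if "v \<in> vertices K" "\<alpha> < g v" "g v \<le> \<beta>" "v \<noteq> w" for v
      using that crit by blast
    note L = fin_complex_sublevel[OF K, of g "g w"]
    \<comment> \<open>The only strong critical vertex of the interval is \<open>w\<close>, so none
      has a value above \<open>g w\<close>, and part (A) applies between the levels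
      \<open>g w\<close> and \<beta>.\<close>
    have "strong_collapses_to (sublevel g K \<beta>) ?L"
    proof (rule sublevel_strong_collapse[OF K w(3)])
      show "\<not> strong_critical g K v" if "v \<in> vertices K" "g w < g v" "g v \<le> \<beta>" for v
        using that w noncrit[of v] by force
    qed
    then have KL: "realization (sublevel g K \<beta>) homotopy_equivalent_space realization ?L"
      using strong_collapse_homotopy_equivalent[OF _ fin_complex_sublevel[OF K]]
      by (auto simp: strong_collapses_to_def)
    have "strong_collapses_to (delete_vertex ?L w) ?M"
    proof (rule punctured_sublevel_strong_collapse[where g = g, OF K w(1,2)])
      show "\<not> strong_critical g K v" if "v \<in> vertices K" "\<alpha> < g v" "g v \<le> g w" "v \<noteq> w" for v
        using that w noncrit[of v] by simp
    qed
    then obtain r where r: "strong_collapse (delete_vertex ?L w) ?M r"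
      by (auto simp: strong_collapses_to_def)
    obtain f where "star_attachment ?L ?M w r f"
      using strong_collapse_retraction[OF r fin_complex_delete_vertex[OF L]] L
      unfolding star_attachment_def by blast
    then interpret star_attachment ?L ?M w r f .
    have "realization (sublevel g K \<beta>) homotopy_equivalent_space attach_space ?L w ?M r"
      using homotopy_eqv_trans[OF KL attach_space_homotopy_equivalent] by (simp add: A_def)
    then show ?thesis
      using r attach_space_regular unfolding A_def descending_star_def by blast
  qed
  show ?thesis using A B by blast
qed

end
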